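(* The matching complexes of finite simple graphs without isolated vertices that are 1-dimensional homology spheres are (up to isomorphism) exactly the cycles $C_4$, $C_5$ and $C_6$. The only such graphs giving these matching complexes are $2P_3$, $C_5$ and $K_{3,2}$, respectively; that is, $M(G)\cong C_4$ if and only if $G\cong 2P_3$, $M(G)\cong C_5$ if and only if $G\cong C_5$, and $M(G)\cong C_6$ if and only if $G\cong K_{3,2}$.
   Context: A matching of a graph $G$ is a set of edges of $G$ no two of which share a vertex. The matching complex $M(G)$ is the simplicial complex whose vertices are the edges of $G$ and whose faces are the matchings of $G$ (including the empty matching). $P_n$ is the path with $n$ vertices, $C_n$ the cycle with $n$ vertices (also regarded as a 1-dimensional simplicial complex), $K_{m,n}$ the complete bipartite graph; $nH$ denotes $n$ disjoint copies of $H$. Fix a field $\Bbbk$; homology is over $\Bbbk$. A homology sphere is a finite $d$-dimensional simplicial complex $\Delta$ such that $\mathrm{link}_\Delta\sigma=\{\tau\in\Delta:\tau\cup\sigma\in\Delta,\tau\cap\sigma=\varnothing\}$ has the homology of a $(d-|\sigma|)$-sphere for all faces $\sigma\in\Delta$, including $\sigma=\varnothing$ (the $(-1)$-sphere is $\{\varnothing\}$). In dimension 1 these are exactly the cycles $C_n$, $n\ge 3$. *)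

theory Defs
  imports Main "HOL-Combinatorics.Permutations"
begin

record 'a graph =
  verts :: "'a set"
  edges :: "'a set set"

definition finite_simple_graph :: "'a graph \<Rightarrow> bool" where
  "finite_simple_graph G \<longleftrightarrow> finite (verts G) \<and> (\<forall>e\<in>edges G. e \<subseteq> verts G \<and> card e = 2)"

definition no_isolated_verts :: "'a graph \<Rightarrow> bool" where
  "no_isolated_verts G \<longleftrightarrow> (\<forall>v\<in>verts G. \<exists>e\<in>edges G. v \<in> e)"

definition graph_iso :: "'a graph \<Rightarrow> 'b graph \<Rightarrow> bool" where
  "graph_iso G H \<longleftrightarrow>
    (\<exists>f. bij_betw f (verts G) (verts H) \<and>
         (\<forall>u\<in>verts G. \<forall>v\<in>verts G. {u, v} \<in> edges G \<longleftrightarrow> {f u, f v} \<in> edges H))"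

definition path_graph :: "nat \<Rightarrow> nat graph" where
  "path_graph n = \<lparr>verts = {..<n}, edges = {{i, Suc i} | i. Suc i < n}\<rparr>"

text \<open>Meaningful for \<open>n \<ge> 3\<close> only.\<close>
definition cycle_graph :: "nat \<Rightarrow> nat graph" where
  "cycle_graph n = \<lparr>verts = {..<n}, edges = {{i, Suc i mod n} | i. i < n}\<rparr>"

definition complete_bipartite_graph :: "nat \<Rightarrow> nat \<Rightarrow> (nat + nat) graph" where
  "complete_bipartite_graph m n =
    \<lparr>verts = Inl ` {..<m} \<union> Inr ` {..<n}, edges = {{Inl i, Inr j} | i j. i < m \<and> j < n}\<rparr>"

definition disjoint_copies :: "nat \<Rightarrow> 'a graph \<Rightarrow> (nat \<times> 'a) graph" where
  "disjoint_copies n H =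
    \<lparr>verts = {..<n} \<times> verts H, edges = {Pair i ` e | i e. i < n \<and> e \<in> edges H}\<rparr>"

text \<open>
  A complex is given by its set of faces, the empty face included; its vertex set is
  the union of the faces.
\<close>

definition finite_simplicial_complex :: "'v set set \<Rightarrow> bool" where
  "finite_simplicial_complex \<Delta> \<longleftrightarrow>
    finite \<Delta> \<and> {} \<in> \<Delta> \<and> (\<forall>\<sigma>\<in>\<Delta>. finite \<sigma> \<and> (\<forall>\<tau>. \<tau> \<subseteq> \<sigma> \<longrightarrow> \<tau> \<in> \<Delta>))"

definition complex_dim :: "'v set set \<Rightarrow> int" where
  "complex_dim \<Delta> = int (Max (card ` \<Delta>)) - 1"

definition complex_iso :: "'v set set \<Rightarrow> 'w set set \<Rightarrow> bool" where
  "complex_iso \<Delta> \<Gamma> \<longleftrightarrow> (\<exists>f. bij_betw f (\<Union>\<Delta>) (\<Union>\<Gamma>) \<and> (`) f ` \<Delta> = \<Gamma>)"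

definition link :: "'v set set \<Rightarrow> 'v set \<Rightarrow> 'v set set" where
  "link \<Delta> \<sigma> = {\<tau> \<in> \<Delta>. \<tau> \<union> \<sigma> \<in> \<Delta> \<and> \<tau> \<inter> \<sigma> = {}}"

definition graph_complex :: "'a graph \<Rightarrow> 'a set set" where
  "graph_complex G = {{}} \<union> {{v} | v. v \<in> verts G} \<union> edges G"

definition matching :: "'a graph \<Rightarrow> 'a set set \<Rightarrow> bool" where
  "matching G M \<longleftrightarrow> M \<subseteq> edges G \<and> pairwise disjnt M"

definition matching_complex :: "'a graph \<Rightarrow> 'a set set set" where
  "matching_complex G = {M. matching G M}"

text \<open>
  Oriented chains: an \<open>i\<close>-chain assigns a coefficient to every ordering of every
  \<open>i\<close>-dimensional face, that is, to lists of \<open>i + 1\<close> distinct vertices, and changes sign under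
  odd permutations.  The value at \<open>[v\<^sub>0, \<dots>, v\<^sub>i]\<close> is the coefficient of the oriented
  simplex \<open>[v\<^sub>0, \<dots>, v\<^sub>i]\<close>.  The empty face spans the chains of degree \<open>-1\<close> (whence the
  homology is reduced), and there are no nonzero chains in lower degrees.
\<close>

definition chains :: "'v set set \<Rightarrow> int \<Rightarrow> ('v list \<Rightarrow> 'k::field) set" where
  "chains \<Delta> i =
    {c. (\<forall>xs. c xs \<noteq> 0 \<longrightarrow> distinct xs \<and> set xs \<in> \<Delta> \<and> int (length xs) = i + 1) \<and>
        (\<forall>xs p. p permutes {..<length xs} \<longrightarrow>
           c (permute_list p xs) = of_int (sign p) * c xs)}"

text \<open>
  The boundary map, read off on coefficients: in
  \<open>\<partial>[v\<^sub>0, \<dots>, v\<^sub>i] = (\<Sum>j. (-1)\<^sup>j [v\<^sub>0, \<dots>, v\<^sub>j\<^sub>-\<^sub>1, v\<^sub>j\<^sub>+\<^sub>1, \<dots>, v\<^sub>i])\<close> the oriented simplex \<open>xs\<close> arises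
  with coefficient \<open>1\<close> from each face oriented as \<open>v # xs\<close>.
\<close>

definition boundary :: "'v set set \<Rightarrow> ('v list \<Rightarrow> 'k::field) \<Rightarrow> 'v list \<Rightarrow> 'k" where
  "boundary \<Delta> c = (\<lambda>xs. \<Sum>v\<in>\<Union>\<Delta>. c (v # xs))"

definition cycles :: "'v set set \<Rightarrow> int \<Rightarrow> ('v list \<Rightarrow> 'k::field) set" where
  "cycles \<Delta> i = {c \<in> chains \<Delta> i. \<forall>xs. boundary \<Delta> c xs = 0}"

definition boundaries :: "'v set set \<Rightarrow> int \<Rightarrow> ('v list \<Rightarrow> 'k::field) set" where
  "boundaries \<Delta> i = boundary \<Delta> ` chains \<Delta> (i + 1)"

definition homologous :: "'v set set \<Rightarrow> int \<Rightarrow> ('v list \<Rightarrow> 'k::field) rel" where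
  "homologous \<Delta> i =
    {(x, y). x \<in> cycles \<Delta> i \<and> y \<in> cycles \<Delta> i \<and> (\<lambda>xs. x xs - y xs) \<in> boundaries \<Delta> i}"

definition homology :: "'v set set \<Rightarrow> int \<Rightarrow> ('v list \<Rightarrow> 'k::field) set set" where
  "homology \<Delta> i = cycles \<Delta> i // homologous \<Delta> i"

text \<open>
  An isomorphism of vector spaces between homology and the ground field.  The vector space
  structure on homology classes is the one induced from cycles.
\<close>

definition homology_iso_field :: "'k::field itself \<Rightarrow> 'v set set \<Rightarrow> int \<Rightarrow> bool" where
  "homology_iso_field _ \<Delta> i \<longleftrightarrow>
    (\<exists>\<phi> :: ('v list \<Rightarrow> 'k) set \<Rightarrow> 'k.
       bij_betw \<phi> (homology \<Delta> i) UNIV \<and>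
       (\<forall>x\<in>cycles \<Delta> i. \<forall>y\<in>cycles \<Delta> i.
          \<phi> (homologous \<Delta> i `` {\<lambda>xs. x xs + y xs}) =
            \<phi> (homologous \<Delta> i `` {x}) + \<phi> (homologous \<Delta> i `` {y})) \<and>
       (\<forall>a. \<forall>x\<in>cycles \<Delta> i.
          \<phi> (homologous \<Delta> i `` {\<lambda>xs. a * x xs}) = a * \<phi> (homologous \<Delta> i `` {x})))"

definition homology_trivial :: "'k::field itself \<Rightarrow> 'v set set \<Rightarrow> int \<Rightarrow> bool" where
  "homology_trivial _ \<Delta> i \<longleftrightarrow> is_singleton (homology \<Delta> i :: ('v list \<Rightarrow> 'k) set set)"

definition has_homology_of_sphere :: "'k::field itself \<Rightarrow> int \<Rightarrow> 'v set set \<Rightarrow> bool" where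
  "has_homology_of_sphere k n \<Delta> \<longleftrightarrow>
    homology_iso_field k \<Delta> n \<and> (\<forall>i. i \<noteq> n \<longrightarrow> homology_trivial k \<Delta> i)"

definition homology_sphere :: "'k::field itself \<Rightarrow> int \<Rightarrow> 'v set set \<Rightarrow> bool" where
  "homology_sphere k d \<Delta> \<longleftrightarrow>
    finite_simplicial_complex \<Delta> \<and> complex_dim \<Delta> = d \<and>
    (\<forall>\<sigma>\<in>\<Delta>. has_homology_of_sphere k (d - int (card \<sigma>)) (link \<Delta> \<sigma>))"

end

theory Submission
  imports Defs "HOL-Library.Countable"
begin

text \<open>
  A one-dimensional homology sphere is a graph in which every vertex has exactly two neighbours
  (its link is a \<open>0\<close>-sphere, that is, two points) and which is connected (its reduced homology in
  degree \<open>0\<close> vanishes); such a finite graph is a cycle.  Conversely a cycle on at least three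
  vertices has the homology required in all links.  This is \<open>homology_sphere_1_iff\<close>, and it turns
  the topological hypothesis into combinatorics: the edges of \<open>G\<close> can be listed as
  \<open>e\<^sub>0, \<dots>, e\<^sub>n\<^sub>-\<^sub>1\<close> around a cycle, and \<open>M(G)\<close> is that cycle.

  If \<open>n \<ge> 4\<close>, this says exactly that \<open>e\<^sub>i\<close> and \<open>e\<^sub>j\<close> are disjoint if and only if they are
  neighbours in the cyclic order, which is the property \<open>cyclic_edges\<close>.  The case \<open>n = 3\<close> is
  impossible, because three pairwise disjoint edges would span a filled triangle.  If \<open>n \<ge> 7\<close>,
  then \<open>e\<^sub>3, e\<^sub>4, e\<^sub>5\<close> all meet both of the disjoint edges \<open>e\<^sub>0\<close> and \<open>e\<^sub>1\<close>, so they join the two.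
  As \<open>e\<^sub>3\<close> and \<open>e\<^sub>5\<close> are both disjoint from \<open>e\<^sub>4\<close>, both are the complement of \<open>e\<^sub>4\<close> in the four
  end points of \<open>e\<^sub>0\<close> and \<open>e\<^sub>1\<close>, and \<open>e\<^sub>3 = e\<^sub>5\<close>, a contradiction (\<open>cyclic_edges_le_6\<close>).

  For \<open>n = 4, 5, 6\<close> the meeting pattern determines the end points of the edges one after another,
  and each time a single graph results: \<open>2P\<^sub>3\<close>, \<open>C\<^sub>5\<close> and \<open>K\<^sub>3\<^sub>,\<^sub>2\<close>
  (\<open>embedding_two_P3\<close>, \<open>embedding_C5\<close>, \<open>embedding_K32\<close>).  In these three graphs a cyclic list of
  edges is exhibited, and it is carried to isomorphic graphs by \<open>cyclic_edges_transfer\<close>.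
\<close>

section \<open>Simplicial homology as linear algebra\<close>

lemma chains_zero: "(\<lambda>_. 0) \<in> chains \<Delta> i"
  by (simp add: chains_def)

lemma chains_add:
  assumes "x \<in> chains \<Delta> i" "y \<in> chains \<Delta> i"
  shows "(\<lambda>xs. x xs + y xs) \<in> chains \<Delta> i"
proof -
  have "x xs \<noteq> 0 \<or> y xs \<noteq> 0" if "x xs + y xs \<noteq> 0" for xs
    using that by auto
  then show ?thesis
    using assms unfolding chains_def mem_Collect_eq distrib_left by metis
qed

lemma chains_scale:
  assumes "x \<in> chains \<Delta> i"
  shows "(\<lambda>xs. a * x xs) \<in> chains \<Delta> i"
  using assms by (simp add: chains_def mult.left_commute)

lemma boundary_add: "boundary \<Delta> (\<lambda>xs. x xs + y xs) = (\<lambda>xs. boundary \<Delta> x xs + boundary \<Delta> y xs)"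
  by (simp add: boundary_def sum.distrib)

lemma boundary_scale: "boundary \<Delta> (\<lambda>xs. a * x xs) = (\<lambda>xs. a * boundary \<Delta> x xs)"
  by (simp add: boundary_def sum_distrib_left)

lemma chains_sum:
  assumes "\<And>j. j \<in> J \<Longrightarrow> x j \<in> chains \<Delta> i"
  shows "(\<lambda>xs. \<Sum>j\<in>J. x j xs) \<in> chains \<Delta> i"
  using assms
proof (induction J rule: infinite_finite_induct)
  case (insert j J)
  then show ?case
    using chains_add[of "x j" \<Delta> i "\<lambda>xs. \<Sum>j\<in>J. x j xs"] by simp
qed (auto simp: chains_zero)

lemma boundary_sum:
  "boundary \<Delta> (\<lambda>xs. \<Sum>j\<in>J. x j xs) = (\<lambda>xs. \<Sum>j\<in>J. boundary \<Delta> (x j) xs)"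
  unfolding boundary_def by (rule ext) (rule sum.swap)

lemma boundary_zero: "boundary \<Delta> (\<lambda>_. 0) = (\<lambda>_. 0)"
  by (simp add: boundary_def)

lemma cycles_zero: "(\<lambda>_. 0) \<in> cycles \<Delta> i"
  by (simp add: cycles_def chains_zero boundary_zero)

lemma cycles_add:
  "x \<in> cycles \<Delta> i \<Longrightarrow> y \<in> cycles \<Delta> i \<Longrightarrow> (\<lambda>xs. x xs + y xs) \<in> cycles \<Delta> i"
  by (simp add: cycles_def chains_add boundary_add)

lemma cycles_scale: "x \<in> cycles \<Delta> i \<Longrightarrow> (\<lambda>xs. a * x xs) \<in> cycles \<Delta> i"
  by (simp add: cycles_def chains_scale boundary_scale)

lemma cycles_diff:
  assumes "x \<in> cycles \<Delta> i" "y \<in> cycles \<Delta> i"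
  shows "(\<lambda>xs. x xs - y xs) \<in> cycles \<Delta> i"
  using cycles_add[OF assms(1) cycles_scale[OF assms(2), of "-1"]] by simp

lemma boundaries_zero: "(\<lambda>_. 0) \<in> boundaries \<Delta> i"
  unfolding boundaries_def
  by (intro image_eqI[of _ _ "\<lambda>_. 0"]) (simp_all add: boundary_zero chains_zero)

lemma boundaries_add:
  assumes "x \<in> boundaries \<Delta> i" "y \<in> boundaries \<Delta> i"
  shows "(\<lambda>xs. x xs + y xs) \<in> boundaries \<Delta> i"
proof -
  obtain c d where "c \<in> chains \<Delta> (i + 1)" "d \<in> chains \<Delta> (i + 1)"
    and "x = boundary \<Delta> c" "y = boundary \<Delta> d"
    using assms by (auto simp: boundaries_def)
  then show ?thesis
    unfolding boundaries_def
    by (intro image_eqI[of _ _ "\<lambda>xs. c xs + d xs"]) (simp_all add: boundary_add chains_add)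
qed

lemma boundaries_scale:
  assumes "x \<in> boundaries \<Delta> i"
  shows "(\<lambda>xs. a * x xs) \<in> boundaries \<Delta> i"
proof -
  obtain c where "c \<in> chains \<Delta> (i + 1)" "x = boundary \<Delta> c"
    using assms by (auto simp: boundaries_def)
  then show ?thesis
    unfolding boundaries_def
    by (intro image_eqI[of _ _ "\<lambda>xs. a * c xs"]) (simp_all add: boundary_scale chains_scale)
qed

lemma boundaries_sum:
  assumes "\<And>j. j \<in> J \<Longrightarrow> x j \<in> boundaries \<Delta> i"
  shows "(\<lambda>xs. \<Sum>j\<in>J. x j xs) \<in> boundaries \<Delta> i"
  using assms
proof (induction J rule: infinite_finite_induct)
  case (insert j J)
  then show ?case
    using boundaries_add[of "x j" \<Delta> i "\<lambda>xs. \<Sum>j\<in>J. x j xs"] by simp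
qed (auto simp: boundaries_zero)

lemma equiv_homologous: "equiv (cycles \<Delta> i) (homologous \<Delta> i :: ('v list \<Rightarrow> 'k::field) rel)"
proof (rule equivI)
  show "homologous \<Delta> i \<subseteq> cycles \<Delta> i \<times> (cycles \<Delta> i :: ('v list \<Rightarrow> 'k) set)"
    by (auto simp: homologous_def)
  show "refl_on (cycles \<Delta> i) (homologous \<Delta> i :: ('v list \<Rightarrow> 'k) rel)"
    by (auto simp: refl_on_def homologous_def boundaries_zero)
  show "sym (homologous \<Delta> i :: ('v list \<Rightarrow> 'k) rel)"
  proof (rule symI)
    fix x y :: "'v list \<Rightarrow> 'k"
    assume "(x, y) \<in> homologous \<Delta> i"
    then show "(y, x) \<in> homologous \<Delta> i"
      using boundaries_scale[of "\<lambda>xs. x xs - y xs" \<Delta> i "-1"] by (simp add: homologous_def)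
  qed
  show "trans (homologous \<Delta> i :: ('v list \<Rightarrow> 'k) rel)"
  proof (rule transI)
    fix x y z :: "'v list \<Rightarrow> 'k"
    assume "(x, y) \<in> homologous \<Delta> i" "(y, z) \<in> homologous \<Delta> i"
    then show "(x, z) \<in> homologous \<Delta> i"
      using boundaries_add[of "\<lambda>xs. x xs - y xs" \<Delta> i "\<lambda>xs. y xs - z xs"]
      by (auto simp: homologous_def)
  qed
qed

lemma homology_class_eq_iff:
  assumes "x \<in> cycles \<Delta> i" "y \<in> cycles \<Delta> i"
  shows "homologous \<Delta> i `` {x} = homologous \<Delta> i `` {y} \<longleftrightarrow>
    (\<lambda>xs. x xs - y xs) \<in> boundaries \<Delta> i"
  using eq_equiv_class_iff[OF equiv_homologous assms] assms by (simp add: homologous_def)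

text \<open>
  Homology classes are sets of cycles, which are awkward to compute with.  This lemma and
  \<open>homology_iso_field_iff\<close> restate the two conditions on homology in terms of cycles and boundaries;
  after them quotients do not occur any more.
\<close>

lemma homology_trivial_iff:
  "homology_trivial TYPE('k::field) \<Delta> i \<longleftrightarrow>
    (cycles \<Delta> i :: ('v list \<Rightarrow> 'k) set) \<subseteq> boundaries \<Delta> i"
proof
  assume "homology_trivial TYPE('k) \<Delta> i"
  then obtain C where C: "(homology \<Delta> i :: ('v list \<Rightarrow> 'k) set set) = {C}"
    by (auto simp: homology_trivial_def is_singleton_def)
  show "(cycles \<Delta> i :: ('v list \<Rightarrow> 'k) set) \<subseteq> boundaries \<Delta> i"
  proof
    fix x :: "'v list \<Rightarrow> 'k"
    assume x: "x \<in> cycles \<Delta> i"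
    have "homologous \<Delta> i `` {y} = C" if "y \<in> cycles \<Delta> i" for y :: "'v list \<Rightarrow> 'k"
      using C quotientI[OF that, of "homologous \<Delta> i"] by (simp add: homology_def)
    then have "homologous \<Delta> i `` {x} = homologous \<Delta> i `` {\<lambda>_. 0}"
      using x cycles_zero by metis
    then show "x \<in> boundaries \<Delta> i"
      using homology_class_eq_iff[OF x cycles_zero] by simp
  qed
next
  assume sub: "(cycles \<Delta> i :: ('v list \<Rightarrow> 'k) set) \<subseteq> boundaries \<Delta> i"
  have "homologous \<Delta> i `` {x} = (cycles \<Delta> i :: ('v list \<Rightarrow> 'k) set)" if "x \<in> cycles \<Delta> i" for x
    using that sub cycles_diff[OF that] by (auto simp: homologous_def)
  then have "(homology \<Delta> i :: ('v list \<Rightarrow> 'k) set set) = {cycles \<Delta> i}"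
    using cycles_zero[of \<Delta> i] by (auto simp: homology_def quotient_def)
  then show "homology_trivial TYPE('k) \<Delta> i"
    by (simp add: homology_trivial_def)
qed

text \<open>
  By the homomorphism theorem, an isomorphism from homology to the field is the same as a
  surjective linear functional on cycles whose kernel consists of the boundaries.
\<close>

lemma homology_iso_field_iff:
  "homology_iso_field TYPE('k::field) \<Delta> i \<longleftrightarrow>
    (\<exists>\<psi> :: ('v list \<Rightarrow> 'k) \<Rightarrow> 'k.
      (\<forall>x\<in>cycles \<Delta> i. \<forall>y\<in>cycles \<Delta> i. \<psi> (\<lambda>xs. x xs + y xs) = \<psi> x + \<psi> y) \<and>
      (\<forall>a. \<forall>x\<in>cycles \<Delta> i. \<psi> (\<lambda>xs. a * x xs) = a * \<psi> x) \<and>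
      \<psi> ` cycles \<Delta> i = UNIV \<and>
      (\<forall>x\<in>cycles \<Delta> i. \<psi> x = 0 \<longleftrightarrow> x \<in> boundaries \<Delta> i))" (is "_ \<longleftrightarrow> ?R")
proof
  let ?Z = "cycles \<Delta> i :: ('v list \<Rightarrow> 'k) set"
  let ?cls = "\<lambda>x. homologous \<Delta> i `` {x :: 'v list \<Rightarrow> 'k}"
  assume "homology_iso_field TYPE('k) \<Delta> i"
  then obtain \<phi> :: "('v list \<Rightarrow> 'k) set \<Rightarrow> 'k" where
    bij: "bij_betw \<phi> (homology \<Delta> i) UNIV" and
    add: "\<forall>x\<in>?Z. \<forall>y\<in>?Z. \<phi> (?cls (\<lambda>xs. x xs + y xs)) = \<phi> (?cls x) + \<phi> (?cls y)" and
    scale: "\<forall>a. \<forall>x\<in>?Z. \<phi> (?cls (\<lambda>xs. a * x xs)) = a * \<phi> (?cls x)"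
    unfolding homology_iso_field_def by blast
  have hom: "homology \<Delta> i = ?cls ` ?Z"
    by (auto simp: homology_def quotient_def)
  have zero: "\<phi> (?cls (\<lambda>_. 0)) = 0"
    using scale[rule_format, OF cycles_zero, of 0] by simp
  have "\<phi> (?cls x) = 0 \<longleftrightarrow> x \<in> boundaries \<Delta> i" if x: "x \<in> ?Z" for x
  proof -
    have "\<phi> (?cls x) = 0 \<longleftrightarrow> ?cls x = ?cls (\<lambda>_. 0)"
      using inj_on_eq_iff[OF bij_betw_imp_inj_on[OF bij], of "?cls x" "?cls (\<lambda>_. 0)"]
        zero x cycles_zero[of \<Delta> i] unfolding hom by auto
    then show ?thesis
      using homology_class_eq_iff[OF x cycles_zero] by simp
  qed
  moreover have "(\<lambda>x. \<phi> (?cls x)) ` ?Z = UNIV"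
    using bij_betw_imp_surj_on[OF bij] unfolding hom image_image .
  ultimately show ?R
    using add scale by (intro exI[of _ "\<lambda>x. \<phi> (?cls x)"]) blast
next
  let ?Z = "cycles \<Delta> i :: ('v list \<Rightarrow> 'k) set"
  let ?cls = "\<lambda>x. homologous \<Delta> i `` {x :: 'v list \<Rightarrow> 'k}"
  assume ?R
  then obtain \<psi> :: "('v list \<Rightarrow> 'k) \<Rightarrow> 'k" where
    add: "\<And>x y. x \<in> ?Z \<Longrightarrow> y \<in> ?Z \<Longrightarrow> \<psi> (\<lambda>xs. x xs + y xs) = \<psi> x + \<psi> y" and
    scale: "\<And>a x. x \<in> ?Z \<Longrightarrow> \<psi> (\<lambda>xs. a * x xs) = a * \<psi> x" and
    surj: "\<psi> ` ?Z = UNIV" and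
    ker: "\<And>x. x \<in> ?Z \<Longrightarrow> \<psi> x = 0 \<longleftrightarrow> x \<in> boundaries \<Delta> i"
    by blast
  have hom: "homology \<Delta> i = ?cls ` ?Z"
    by (auto simp: homology_def quotient_def)
  have eq: "\<psi> x = \<psi> y \<longleftrightarrow> ?cls x = ?cls y" if "x \<in> ?Z" "y \<in> ?Z" for x y
  proof -
    have "\<psi> (\<lambda>xs. x xs - y xs) = \<psi> x - \<psi> y"
      using add[OF that(1) cycles_scale[OF that(2), of "-1"]] scale[OF that(2), of "-1"] by simp
    then show ?thesis
      using ker[OF cycles_diff[OF that]] homology_class_eq_iff[OF that] by simp
  qed
  \<comment> \<open>\<open>\<psi>\<close> is constant on each class, so any representative will do.\<close>
  define \<phi> where "\<phi> C = \<psi> (SOME x. x \<in> C)" for C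
  have \<phi>: "\<phi> (?cls x) = \<psi> x" if x: "x \<in> ?Z" for x
  proof -
    have "x \<in> ?cls x"
      using x by (simp add: homologous_def boundaries_zero)
    then have "(SOME y. y \<in> ?cls x) \<in> ?cls x"
      by (rule someI[of "\<lambda>y. y \<in> ?cls x"])
    then have "(SOME y. y \<in> ?cls x) \<in> ?Z" "?cls (SOME y. y \<in> ?cls x) = ?cls x"
      using equiv_class_eq[OF equiv_homologous, of x "SOME y. y \<in> ?cls x" \<Delta> i]
      by (auto simp: homologous_def)
    then show ?thesis
      using eq x by (simp add: \<phi>_def)
  qed
  have "bij_betw \<phi> (homology \<Delta> i) UNIV"
    unfolding bij_betw_def
  proof
    show "inj_on \<phi> (homology \<Delta> i)"
      by (auto simp: hom inj_on_def \<phi> eq)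
    show "\<phi> ` homology \<Delta> i = UNIV"
      using surj unfolding hom image_image by (simp add: \<phi>)
  qed
  then show "homology_iso_field TYPE('k) \<Delta> i"
    unfolding homology_iso_field_def
    by (intro exI[of _ \<phi>]) (simp add: \<phi> add scale cycles_add cycles_scale)
qed

section \<open>Small chains and spheres of dimension at most zero\<close>

lemma chains_swap:
  assumes "c \<in> chains \<Delta> i"
  shows "c [u, w] = - c [w, u]"
proof -
  let ?p = "transpose 0 (1::nat)"
  have "?p permutes {..<length [w, u]}"
    by (rule permutes_swap_id) auto
  then have "c (permute_list ?p [w, u]) = of_int (sign ?p) * c [w, u]"
    using assms unfolding chains_def by blast
  moreover have "permute_list ?p [w, u] = [u, w]"
    by (simp add: permute_list_def upt_rec)
  ultimately show ?thesis
    by (simp add: sign_swap_id)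
qed

text \<open>
  A list with at most one entry has only the trivial reordering, so in degrees up to \<open>0\<close> the
  sign rule for chains is automatic.
\<close>

lemma chainsI_dim_le_0:
  assumes supp: "\<And>xs. c xs \<noteq> 0 \<Longrightarrow> distinct xs \<and> set xs \<in> \<Delta> \<and> int (length xs) = i + 1"
    and "i \<le> 0"
  shows "c \<in> chains \<Delta> i"
proof -
  have "c (permute_list p xs) = of_int (sign p) * c xs" if p: "p permutes {..<length xs}" for xs p
  proof (cases "length xs \<le> 1")
    case True
    then have "p = id"
      using p by (cases "length xs") (auto simp: lessThan_Suc)
    then show ?thesis
      by simp
  next
    case False
    then have "c xs = 0" "c (permute_list p xs) = 0"
      using supp[of xs] supp[of "permute_list p xs"] \<open>i \<le> 0\<close> by force+
    then show ?thesis
      by simp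
  qed
  then show ?thesis
    using supp by (simp add: chains_def)
qed

text \<open>
  For an edge, the only nontrivial reordering exchanges the two ends.
\<close>

lemma chainsI_dim_1:
  assumes supp: "\<And>xs. c xs \<noteq> 0 \<Longrightarrow> \<exists>u w. xs = [u, w] \<and> u \<noteq> w \<and> {u, w} \<in> \<Delta>"
    and swap: "\<And>u w. c [u, w] = - c [w, u]"
  shows "c \<in> chains \<Delta> 1"
proof -
  have "c (permute_list p xs) = of_int (sign p) * c xs" if p: "p permutes {..<length xs}" for xs p
  proof (cases "length xs = 2")
    case True
    then obtain u w where xs: "xs = [u, w]"
      by (auto simp: numeral_2_eq_2 length_Suc_conv)
    then have "{..<length xs} = {0, 1}"
      by auto
    then consider "p = id" | "p = transpose 0 1"
      using p permutes_doubleton_iff by metis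
    then show ?thesis
    proof cases
      case 2
      then have "permute_list p xs = [w, u]"
        by (simp add: xs permute_list_def upt_rec)
      then show ?thesis
        using 2 swap[of w u] by (simp add: xs sign_swap_id)
    qed simp
  next
    case False
    then have "c xs = 0" "c (permute_list p xs) = 0"
      using supp[of xs] supp[of "permute_list p xs"] by (force dest: arg_cong[of _ _ length])+
    then show ?thesis
      by simp
  qed
  moreover have "distinct xs \<and> set xs \<in> \<Delta> \<and> int (length xs) = 1 + 1" if "c xs \<noteq> 0" for xs
    using supp[OF that] by auto
  ultimately show ?thesis
    by (simp add: chains_def)
qed

definition point_chain :: "'v \<Rightarrow> 'v list \<Rightarrow> 'k::field" where
  "point_chain w = (\<lambda>xs. of_bool (xs = [w]))"

text \<open>
  The oriented edge from \<open>u\<close> to \<open>w\<close>, whose boundary is \<open>w - u\<close>.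
\<close>

definition edge_chain :: "'v \<Rightarrow> 'v \<Rightarrow> 'v list \<Rightarrow> 'k::field" where
  "edge_chain u w = (\<lambda>xs. of_bool (xs = [u, w]) - of_bool (xs = [w, u]))"

lemma point_chain_in_chains: "{w} \<in> \<Delta> \<Longrightarrow> point_chain w \<in> chains \<Delta> 0"
  by (rule chainsI_dim_le_0) (auto simp: point_chain_def)

lemma edge_chain_in_chains: "u \<noteq> w \<Longrightarrow> {u, w} \<in> \<Delta> \<Longrightarrow> edge_chain u w \<in> chains \<Delta> 1"
  by (rule chainsI_dim_1)
    (auto simp: edge_chain_def insert_commute of_bool_def split: if_split_asm)

lemma boundary_point_chain:
  assumes "finite (\<Union>\<Delta>)" "w \<in> \<Union>\<Delta>"
  shows "boundary \<Delta> (point_chain w) = (\<lambda>xs. of_bool (xs = []))"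
proof
  fix xs
  have "boundary \<Delta> (point_chain w) xs = (\<Sum>u\<in>\<Union>\<Delta>. if u = w then of_bool (xs = []) else 0)"
    unfolding boundary_def point_chain_def by (rule sum.cong) auto
  then show "boundary \<Delta> (point_chain w) xs = of_bool (xs = [])"
    using assms by (simp add: sum.delta)
qed

lemma boundary_edge_chain:
  assumes "finite (\<Union>\<Delta>)" "u \<in> \<Union>\<Delta>" "w \<in> \<Union>\<Delta>"
  shows "boundary \<Delta> (edge_chain u w) = (\<lambda>xs. point_chain w xs - point_chain u xs)"
proof
  fix xs
  have "boundary \<Delta> (edge_chain u w) xs =
      (\<Sum>a\<in>\<Union>\<Delta>. if a = u then point_chain w xs else 0) -
      (\<Sum>a\<in>\<Union>\<Delta>. if a = w then point_chain u xs else 0)"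
    unfolding boundary_def point_chain_def edge_chain_def sum_subtractf[symmetric]
    by (rule sum.cong) auto
  then show "boundary \<Delta> (edge_chain u w) xs = point_chain w xs - point_chain u xs"
    using assms by (simp add: sum.delta)
qed

lemma chains_eq_zero:
  assumes "\<And>\<sigma>. \<sigma> \<in> \<Delta> \<Longrightarrow> int (card \<sigma>) \<noteq> i + 1"
  shows "chains \<Delta> i = {\<lambda>_. 0}"
proof -
  have "c = (\<lambda>_. 0)" if "c \<in> chains \<Delta> i" for c
  proof
    fix xs
    show "c xs = 0"
      using that assms[of "set xs"] distinct_card[of xs] unfolding chains_def by force
  qed
  then show ?thesis
    using chains_zero by blast
qed

lemma homology_trivial_if_no_faces:
  assumes "\<And>\<sigma>. \<sigma> \<in> \<Delta> \<Longrightarrow> int (card \<sigma>) \<noteq> i + 1"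
  shows "homology_trivial TYPE('k::field) \<Delta> i"
proof -
  have "(chains \<Delta> i :: ('a list \<Rightarrow> 'k) set) = {\<lambda>_. 0}"
    using assms by (rule chains_eq_zero)
  then show ?thesis
    by (auto simp: homology_trivial_iff cycles_def boundaries_zero)
qed

lemma boundaries_eq_zero:
  assumes "\<And>\<sigma>. \<sigma> \<in> \<Delta> \<Longrightarrow> int (card \<sigma>) \<noteq> i + 2"
  shows "(boundaries \<Delta> i :: ('v list \<Rightarrow> 'k::field) set) = {\<lambda>_. 0}"
proof -
  have "(chains \<Delta> (i + 1) :: ('v list \<Rightarrow> 'k) set) = {\<lambda>_. 0}"
    using assms by (intro chains_eq_zero) fastforce
  then show ?thesis
    by (simp add: boundaries_def boundary_zero)
qed

text \<open>
  In degree \<open>-1\<close> reduced homology only detects whether there is a vertex at all: the empty face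
  is the boundary of any vertex.
\<close>

lemma homology_trivial_neg_1:
  fixes \<Delta> :: "'v set set"
  assumes "finite (\<Union>\<Delta>)" "{a} \<in> \<Delta>"
  shows "homology_trivial TYPE('k::field) \<Delta> (-1)"
  unfolding homology_trivial_iff
proof
  fix c :: "'v list \<Rightarrow> 'k"
  assume "c \<in> cycles \<Delta> (-1)"
  then have "c xs = 0" if "xs \<noteq> []" for xs
    using that by (auto simp: cycles_def chains_def)
  moreover have "a \<in> \<Union>\<Delta>"
    using assms(2) by blast
  ultimately have "c = boundary \<Delta> (\<lambda>xs. c [] * point_chain a xs)"
    by (auto simp: boundary_scale boundary_point_chain[OF assms(1)] fun_eq_iff)
  moreover have "(\<lambda>xs. c [] * point_chain a xs) \<in> chains \<Delta> (-1 + 1)"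
    using chains_scale[OF point_chain_in_chains[OF assms(2)]] by simp
  ultimately show "c \<in> boundaries \<Delta> (-1)"
    unfolding boundaries_def by blast
qed

lemma sphere_empty_face: "has_homology_of_sphere TYPE('k::field) (-1) {{}}"
  unfolding has_homology_of_sphere_def
proof (intro conjI allI impI)
  fix i :: int
  assume "i \<noteq> -1"
  then show "homology_trivial TYPE('k) {{}} i"
    by (intro homology_trivial_if_no_faces) auto
next
  have b: "boundaries {{}} (-1) = {\<lambda>_. 0 :: 'k}"
    by (rule boundaries_eq_zero) simp
  have supp: "c xs = 0" if "xs \<noteq> []" "c \<in> cycles {{}} (-1)" for xs and c :: "'a list \<Rightarrow> 'k"
    using that by (auto simp: cycles_def chains_def)
  have "(\<lambda>xs. if xs = [] then t else 0) \<in> cycles {{}} (-1)" for t :: 'k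
    unfolding cycles_def by (auto intro!: chainsI_dim_le_0 simp: boundary_def split: if_splits)
  then have "t \<in> (\<lambda>c. c []) ` cycles {{}} (-1)" for t :: 'k
    by (rule rev_image_eqI) simp
  moreover have "c [] = 0 \<longleftrightarrow> c = (\<lambda>_. 0)" if "c \<in> cycles {{}} (-1)" for c :: "'a list \<Rightarrow> 'k"
    using supp[OF _ that] by (metis ext)
  ultimately show "homology_iso_field TYPE('k) ({{}} :: 'a set set) (-1)"
    unfolding homology_iso_field_iff b by (intro exI[of _ "\<lambda>c. c []"]) auto
qed

text \<open>
  A \<open>0\<close>-cycle on two points has opposite coefficients at them, so it is determined by its value
  at one point, and there are no edges to produce boundaries.
\<close>

lemma sphere_two_points:
  assumes "a \<noteq> b"
  shows "has_homology_of_sphere TYPE('k::field) 0 {{}, {a}, {b}}"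
  unfolding has_homology_of_sphere_def
proof (intro conjI allI impI)
  fix i :: int
  assume "i \<noteq> 0"
  then show "homology_trivial TYPE('k) {{}, {a}, {b}} i"
    using homology_trivial_neg_1[of "{{}, {a}, {b}}" a]
    by (cases "i = -1") (auto intro!: homology_trivial_if_no_faces)
next
  let ?\<Delta> = "{{}, {a}, {b}}"
  have b: "boundaries ?\<Delta> 0 = {\<lambda>_. 0 :: 'k}"
    by (rule boundaries_eq_zero) auto
  let ?c = "\<lambda>t xs. t * (point_chain a xs + -1 * point_chain b xs) :: 'k"
  have "?c t \<in> chains ?\<Delta> 0" for t
    by (intro chains_scale chains_add point_chain_in_chains) simp_all
  moreover have "boundary ?\<Delta> (?c t) = (\<lambda>_. 0)" for t
    by (simp only: boundary_scale boundary_add) (simp add: boundary_point_chain)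
  ultimately have "?c t \<in> cycles ?\<Delta> 0" for t
    by (simp add: cycles_def)
  then have "t \<in> (\<lambda>c. c [a]) ` cycles ?\<Delta> 0" for t :: 'k
    by (rule rev_image_eqI[of "?c t"]) (simp add: point_chain_def assms)
  moreover have "c = (\<lambda>_. 0)" if c: "c \<in> cycles ?\<Delta> 0" and 0: "c [a] = 0" for c :: "'a list \<Rightarrow> 'k"
  proof
    fix xs
    have "boundary ?\<Delta> c [] = 0"
      using c by (simp add: cycles_def)
    then have "c [b] = 0"
      using 0 assms by (simp add: boundary_def)
    then show "c xs = 0"
      using c 0 by (cases xs) (auto simp: cycles_def chains_def)
  qed
  ultimately show "homology_iso_field TYPE('k) ?\<Delta> 0"
    unfolding homology_iso_field_iff b by (intro exI[of _ "\<lambda>c. c [a]"]) auto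
qed

section \<open>The homology of a cycle\<close>

text \<open>
  The cycle through \<open>v 0, \<dots>, v (n - 1)\<close> as a complex on the vertices themselves, not only up to
  isomorphism.  Complexes isomorphic to \<open>C\<^sub>n\<close> are exactly those of this form with \<open>v\<close> injective, so
  that homology never has to be transported along an isomorphism.
\<close>

definition cycle_complex :: "nat \<Rightarrow> (nat \<Rightarrow> 'v) \<Rightarrow> 'v set set" where
  "cycle_complex n v =
    {{}} \<union> (\<lambda>i. {v i}) ` {..<n} \<union> (\<lambda>i. {v i, v (Suc i mod n)}) ` {..<n}"

lemma Suc_mod_less: "i < n \<Longrightarrow> Suc i mod n = (if Suc i = n then 0 else Suc i)"
  by auto

lemma Union_cycle_complex: "\<Union>(cycle_complex n v) = v ` {..<n}"
proof (cases "n = 0")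
  case False
  then show ?thesis
    by (auto simp: cycle_complex_def)
qed (simp add: cycle_complex_def)

lemma edge_in_cycle_complex_iff:
  assumes "inj_on v {..<n}" "i < n" "j < n" "i \<noteq> j"
  shows "{v i, v j} \<in> cycle_complex n v \<longleftrightarrow> j = Suc i mod n \<or> i = Suc j mod n"
proof
  assume "{v i, v j} \<in> cycle_complex n v"
  moreover have "v i \<noteq> v j"
    using assms by (simp add: inj_on_eq_iff)
  ultimately obtain k where k: "k < n" "{v i, v j} = {v k, v (Suc k mod n)}"
    by (auto simp: cycle_complex_def)
  then have "Suc k mod n < n"
    by simp
  then show "j = Suc i mod n \<or> i = Suc j mod n"
    using k assms by (auto simp: doubleton_eq_iff inj_on_eq_iff[OF assms(1)])
next
  assume "j = Suc i mod n \<or> i = Suc j mod n"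
  then show "{v i, v j} \<in> cycle_complex n v"
    using assms by (auto simp: cycle_complex_def insert_commute)
qed

lemma cycle_predecessor:
  assumes "i < n"
  obtains p where "p < n" "Suc p mod n = i"
proof
  show "(if i = 0 then n - 1 else i - 1) < n" "Suc (if i = 0 then n - 1 else i - 1) mod n = i"
    using assms by auto
qed

lemma card_face_cycle_complex: "\<sigma> \<in> cycle_complex n v \<Longrightarrow> finite \<sigma> \<and> card \<sigma> \<le> 2"
  by (auto simp: cycle_complex_def card_insert_if)

locale embedded_cycle =
  fixes n :: nat and v :: "nat \<Rightarrow> 'v"
  assumes n: "n \<ge> 3" and inj: "inj_on v {..<n}"
begin

abbreviation next_index :: "nat \<Rightarrow> nat" where
  "next_index i \<equiv> Suc i mod n"

abbreviation \<Delta> :: "'v set set" where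
  "\<Delta> \<equiv> cycle_complex n v"

lemma next_lt [simp]: "next_index i < n"
  using n by simp

lemma v_eq_iff: "i < n \<Longrightarrow> j < n \<Longrightarrow> v i = v j \<longleftrightarrow> i = j"
  using inj by (simp add: inj_on_eq_iff)

lemma next_neq: "i < n \<Longrightarrow> next_index i \<noteq> i"
  using n by (auto simp: Suc_mod_less)

lemma next_next_neq: "i < n \<Longrightarrow> next_index (next_index i) \<noteq> i"
  using n by (auto simp: Suc_mod_less)

lemma next_inj: "i < n \<Longrightarrow> j < n \<Longrightarrow> next_index i = next_index j \<longleftrightarrow> i = j"
  by (auto simp: Suc_mod_less split: if_splits)

lemma finite_verts: "finite (\<Union>\<Delta>)"
  by (simp add: Union_cycle_complex)

lemma empty_face: "{} \<in> \<Delta>"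
  by (simp add: cycle_complex_def)

lemma vertex_face: "i < n \<Longrightarrow> {v i} \<in> \<Delta>"
  by (auto simp: cycle_complex_def)

lemma edge_face: "i < n \<Longrightarrow> {v i, v (next_index i)} \<in> \<Delta>"
  by (auto simp: cycle_complex_def)

text \<open>
  Walking along the cycle shows that every vertex is homologous to \<open>v 0\<close>.  A \<open>0\<close>-cycle has
  coefficients with sum zero, so it is a combination of such differences.
\<close>

lemma homology_0_trivial: "homology_trivial TYPE('k::field) \<Delta> 0"
  unfolding homology_trivial_iff
proof
  fix c :: "'v list \<Rightarrow> 'k"
  assume c: "c \<in> cycles \<Delta> 0"
  have to_base: "(\<lambda>xs. point_chain (v i) xs - point_chain (v 0) xs :: 'k) \<in> boundaries \<Delta> 0"
    if "i < n" for i
    using that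
  proof (induction i)
    case 0
    then show ?case
      using boundaries_zero by simp
  next
    case (Suc i)
    then have e: "edge_chain (v i) (v (Suc i)) \<in> chains \<Delta> (0 + 1)"
      using edge_face[of i] v_eq_iff[of i "Suc i"] by (auto intro: edge_chain_in_chains)
    moreover have "boundary \<Delta> (edge_chain (v i) (v (Suc i))) =
        (\<lambda>xs. point_chain (v (Suc i)) xs - point_chain (v i) xs :: 'k)"
      using Suc.prems by (intro boundary_edge_chain) (auto simp: Union_cycle_complex)
    ultimately have "(\<lambda>xs. point_chain (v (Suc i)) xs - point_chain (v i) xs :: 'k)
        \<in> boundaries \<Delta> 0"
      unfolding boundaries_def by (metis imageI)
    from boundaries_add[OF this Suc.IH] Suc.prems show ?case
      by simp
  qed
  have sum0: "(\<Sum>i<n. c [v i]) = 0"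
  proof -
    have "boundary \<Delta> c [] = 0"
      using c by (simp add: cycles_def)
    then show ?thesis
      by (simp add: boundary_def Union_cycle_complex sum.reindex[OF inj])
  qed
  have "c xs = (\<Sum>i<n. c [v i] * (point_chain (v i) xs - point_chain (v 0) xs))" for xs
  proof -
    have "(\<Sum>i<n. c [v i] * (point_chain (v i) xs - point_chain (v 0) xs)) =
        (\<Sum>i<n. c [v i] * point_chain (v i) xs)"
      using sum0 by (simp add: right_diff_distrib sum_subtractf flip: sum_distrib_right)
    also have "\<dots> = c xs"
    proof (cases "\<exists>j<n. xs = [v j]")
      case True
      then obtain j where j: "j < n" "xs = [v j]"
        by blast
      then have "(\<Sum>i<n. c [v i] * point_chain (v i) xs) = (\<Sum>i<n. if i = j then c [v j] else 0)"
        by (intro sum.cong) (auto simp: point_chain_def v_eq_iff)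
      then show ?thesis
        using j by simp
    next
      case False
      then have "c xs = 0"
        using c unfolding cycles_def chains_def
        by (cases xs) (force simp: cycle_complex_def)+
      moreover have "point_chain (v i) xs = (0 :: 'k)" if "i < n" for i
        using False that by (auto simp: point_chain_def)
      ultimately show ?thesis
        by simp
    qed
    finally show ?thesis ..
  qed
  then have "c = (\<lambda>xs. \<Sum>i<n. c [v i] * (point_chain (v i) xs - point_chain (v 0) xs))"
    by blast
  also have "\<dots> \<in> boundaries \<Delta> 0"
    using to_base by (intro boundaries_sum boundaries_scale) simp
  finally show "c \<in> boundaries \<Delta> 0" .
qed

text \<open>
  At each vertex the boundary of a \<open>1\<close>-cycle compares the coefficients of the incoming and the
  outgoing edge, which are the only edges there.  Hence a \<open>1\<close>-cycle is constant along the oriented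
  cycle.
\<close>

lemma cycle_coefficients_agree:
  fixes c :: "'v list \<Rightarrow> 'k::field"
  assumes c: "c \<in> cycles \<Delta> 1" and "i < n"
  shows "c [v i, v (next_index i)] = c [v 0, v 1]"
  using \<open>i < n\<close>
proof (induction i)
  case 0
  then show ?case
    using n by simp
next
  case (Suc i)
  let ?j = "Suc i"
  have chain: "c \<in> chains \<Delta> 1"
    using c by (simp add: cycles_def)
  have supp: "u = v i \<or> u = v (next_index ?j)" if "u \<in> \<Union>\<Delta>" "c [u, v ?j] \<noteq> 0" for u
  proof -
    obtain k where k: "k < n" "u = v k"
      using \<open>u \<in> \<Union>\<Delta>\<close> by (auto simp: Union_cycle_complex)
    with that chain have "v k \<noteq> v ?j" "{v k, v ?j} \<in> \<Delta>"
      by (force simp: chains_def)+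
    then have "?j = next_index k \<or> k = next_index ?j"
      using edge_in_cycle_complex_iff[OF inj k(1) Suc.prems] by auto
    then show ?thesis
      using k Suc.prems next_inj[of i k] by auto
  qed
  have "v i \<noteq> v (next_index ?j)"
    using Suc.prems next_next_neq[of i] by (simp add: v_eq_iff)
  then have "c [v i, v ?j] + c [v (next_index ?j), v ?j] =
      (\<Sum>u\<in>{v i, v (next_index ?j)}. c [u, v ?j])"
    by simp
  also have "\<dots> = boundary \<Delta> c [v ?j]"
    unfolding boundary_def using supp Suc.prems
    by (intro sum.mono_neutral_left) (auto simp: Union_cycle_complex)
  also have "\<dots> = 0"
    using c by (simp add: cycles_def)
  finally have "c [v i, v ?j] = c [v ?j, v (next_index ?j)]"
    using chains_swap[OF chain, of "v (next_index ?j)" "v ?j"] by (simp add: eq_neg_iff_add_eq_0)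
  then show ?case
    using Suc by simp
qed

text \<open>
  The functional that reads off the coefficient of the first edge is injective on \<open>1\<close>-cycles by
  \<open>cycle_coefficients_agree\<close>, and the sum of all oriented edges is a \<open>1\<close>-cycle with value \<open>1\<close>.
  There are no triangles, so the only boundary is zero.
\<close>

lemma homology_1_iso: "homology_iso_field TYPE('k::field) \<Delta> 1"
proof -
  have bd: "boundaries \<Delta> 1 = {\<lambda>_. 0 :: 'k}"
    using card_face_cycle_complex[of _ n v] by (intro boundaries_eq_zero) fastforce
  define z :: "'v list \<Rightarrow> 'k" where "z = (\<lambda>xs. \<Sum>i<n. edge_chain (v i) (v (next_index i)) xs)"
  have rotate: "(\<Sum>i<n. g (next_index i)) = (\<Sum>i<n. g i)" for g :: "nat \<Rightarrow> 'k"
  proof -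
    obtain m where "n = Suc m"
      using n by (cases n) auto
    moreover have "(\<Sum>i<m. g (Suc i mod Suc m)) = (\<Sum>i<m. g (Suc i))"
      by (intro sum.cong) auto
    ultimately show ?thesis
      using sum.lessThan_Suc_shift[of g m] by (simp add: add.commute)
  qed
  have z: "z \<in> cycles \<Delta> 1"
  proof -
    have "z \<in> chains \<Delta> 1"
      unfolding z_def
      by (intro chains_sum edge_chain_in_chains)
        (auto simp: v_eq_iff next_neq[symmetric] intro: edge_face)
    moreover have "boundary \<Delta> z xs = 0" for xs
    proof -
      have "boundary \<Delta> z xs =
          (\<Sum>i<n. point_chain (v (next_index i)) xs - point_chain (v i) xs)"
        unfolding z_def boundary_sum
        by (intro sum.cong refl)
          (subst boundary_edge_chain; use finite_verts in \<open>auto simp: Union_cycle_complex\<close>)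
      then show ?thesis
        using rotate[of "\<lambda>i. point_chain (v i) xs"] by (simp add: sum_subtractf)
    qed
    ultimately show ?thesis
      by (simp add: cycles_def)
  qed
  have "z [v 0, v 1] = (\<Sum>i<n. if i = 0 then 1 else 0)"
    unfolding z_def using n
    by (intro sum.cong) (auto simp: edge_chain_def v_eq_iff Suc_mod_less)
  then have "z [v 0, v 1] = 1"
    using n by simp
  then have "t \<in> (\<lambda>c. c [v 0, v 1]) ` cycles \<Delta> 1" for t :: 'k
    by (intro rev_image_eqI[OF cycles_scale[OF z, of t]]) simp
  moreover have "c = (\<lambda>_. 0)" if c: "c \<in> cycles \<Delta> 1" and 0: "c [v 0, v 1] = 0"
    for c :: "'v list \<Rightarrow> 'k"
  proof (rule ext, rule ccontr)
    fix xs
    assume "c xs \<noteq> 0"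
    moreover have chain: "c \<in> chains \<Delta> 1"
      using c by (simp add: cycles_def)
    ultimately have "distinct xs" "set xs \<in> \<Delta>" "length xs = 2"
      by (auto simp: chains_def)
    then obtain a b where ab: "xs = [a, b]" "a \<noteq> b" "{a, b} \<in> \<Delta>"
      by (auto simp: numeral_2_eq_2 length_Suc_conv)
    then obtain i where "i < n" "{a, b} = {v i, v (next_index i)}"
      by (auto simp: cycle_complex_def)
    then have "c [a, b] = 0"
      using cycle_coefficients_agree[OF c, of i] 0 chains_swap[OF chain, of a b]
      by (auto simp: doubleton_eq_iff)
    then show False
      using \<open>c xs \<noteq> 0\<close> ab by simp
  qed
  ultimately show ?thesis
    unfolding homology_iso_field_iff bd by (intro exI[of _ "\<lambda>c. c [v 0, v 1]"]) auto
qed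

lemma sphere_cycle: "has_homology_of_sphere TYPE('k::field) 1 \<Delta>"
  unfolding has_homology_of_sphere_def
proof (intro conjI allI impI homology_1_iso)
  fix i :: int
  assume "i \<noteq> 1"
  then consider "i = -1" | "i = 0" | "i < -1 \<or> i > 1"
    by linarith
  then show "homology_trivial TYPE('k) \<Delta> i"
  proof cases
    case 1
    then show ?thesis
      using homology_trivial_neg_1[OF finite_verts vertex_face[of 0]] n by simp
  next
    case 2
    then show ?thesis
      by (simp add: homology_0_trivial)
  next
    case 3
    then show ?thesis
      using card_face_cycle_complex[of _ n v] by (intro homology_trivial_if_no_faces) fastforce
  qed
qed

lemma simplicial_complex: "finite_simplicial_complex \<Delta>"
proof -
  have "\<tau> \<in> \<Delta>" if "\<sigma> \<in> \<Delta>" "\<tau> \<subseteq> \<sigma>" for \<sigma> \<tau>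
  proof -
    from \<open>\<sigma> \<in> \<Delta>\<close> consider "\<sigma> = {}" | i where "i < n" "\<sigma> = {v i}"
      | i where "i < n" "\<sigma> = {v i, v (next_index i)}"
      by (auto simp: cycle_complex_def)
    then show ?thesis
    proof cases
      case 1
      then show ?thesis
        using that by simp
    next
      case 2
      then have "\<tau> = {} \<or> \<tau> = {v i}"
        using that by blast
      then show ?thesis
        using 2 vertex_face empty_face by auto
    next
      case 3
      then have "\<tau> = {} \<or> \<tau> = {v i} \<or> \<tau> = {v (next_index i)} \<or> \<tau> = \<sigma>"
        using that by blast
      then show ?thesis
        using 3 that vertex_face empty_face by auto
    qed
  qed
  moreover have "finite \<Delta>"
    by (simp add: cycle_complex_def)
  ultimately show ?thesis
    using empty_face card_face_cycle_complex[of _ n v]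
    unfolding finite_simplicial_complex_def by blast
qed

lemma dim: "complex_dim \<Delta> = 1"
proof -
  have "card {v 0, v (next_index 0)} = 2"
    using n by (simp add: v_eq_iff)
  moreover have "{v 0, v (next_index 0)} \<in> \<Delta>"
    using edge_face[of 0] n by simp
  ultimately have "2 \<in> card ` \<Delta>"
    by force
  then have "Max (card ` \<Delta>) = 2"
    using simplicial_complex card_face_cycle_complex[of _ n v]
    by (intro Max_eqI) (auto simp: finite_simplicial_complex_def)
  then show ?thesis
    by (simp add: complex_dim_def)
qed

text \<open>
  The vertex is named by its predecessor \<open>p\<close> so that both neighbours can be written down without
  subtraction modulo \<open>n\<close>.
\<close>

lemma link_vertex:
  assumes "p < n"
  defines "i \<equiv> next_index p"
  shows "link \<Delta> {v i} = {{}, {v p}, {v (next_index i)}}"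
proof (intro set_eqI iffI)
  fix \<tau>
  assume "\<tau> \<in> link \<Delta> {v i}"
  then have \<tau>: "insert (v i) \<tau> \<in> \<Delta>" "v i \<notin> \<tau>"
    by (auto simp: link_def)
  show "\<tau> \<in> {{}, {v p}, {v (next_index i)}}"
  proof (cases "\<tau> = {}")
    case False
    with \<tau> obtain k where k: "k < n" "insert (v i) \<tau> = {v k, v (next_index k)}"
      unfolding cycle_complex_def by (auto simp: insert_eq_iff)
    then have "\<tau> = {v k, v (next_index k)} - {v i}"
      using \<tau>(2) by (metis Diff_insert_absorb)
    moreover have "v i = v k \<or> v i = v (next_index k)"
      using k(2) by blast
    then have "i = k \<or> p = k"
      using assms k(1) next_inj by (auto simp: v_eq_iff)
    ultimately show ?thesis
      using k(1) assms next_neq v_eq_iff[of k "next_index k"] by auto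
  qed simp
next
  fix \<tau>
  assume "\<tau> \<in> {{}, {v p}, {v (next_index i)}}"
  moreover have "v p \<noteq> v i" "v (next_index i) \<noteq> v i"
    using assms next_neq[of p] next_neq[of "next_index p"] by (auto simp: v_eq_iff)
  moreover have "{} \<in> \<Delta>"
    by (simp add: cycle_complex_def)
  ultimately show "\<tau> \<in> link \<Delta> {v i}"
    using vertex_face[of p] vertex_face[of i] vertex_face[of "next_index i"] edge_face[of p]
      edge_face[of i] assms
    by (auto simp: link_def insert_commute)
qed

lemma link_edge:
  assumes "\<sigma> \<in> \<Delta>" "card \<sigma> = 2"
  shows "link \<Delta> \<sigma> = {{}}"
proof -
  have "\<tau> = {}" if "\<tau> \<in> \<Delta>" "\<tau> \<union> \<sigma> \<in> \<Delta>" "\<tau> \<inter> \<sigma> = {}" for \<tau>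
  proof -
    have "finite \<tau>" "finite \<sigma>" "card (\<tau> \<union> \<sigma>) \<le> 2"
      using that assms card_face_cycle_complex[of _ n v] by blast+
    then show ?thesis
      using that assms card_Un_disjoint[of \<tau> \<sigma>] by simp
  qed
  moreover have "{} \<in> \<Delta>"
    by (simp add: cycle_complex_def)
  ultimately show ?thesis
    using assms by (auto simp: link_def)
qed

text \<open>
  The links of a cycle are the cycle itself, two points, and the complex with only the empty
  face: a \<open>1\<close>-sphere, a \<open>0\<close>-sphere and the \<open>-1\<close>-sphere.
\<close>

theorem homology_sphere_cycle: "homology_sphere TYPE('k::field) 1 \<Delta>"
  unfolding homology_sphere_def
proof (intro conjI ballI simplicial_complex dim)
  fix \<sigma>
  assume \<sigma>: "\<sigma> \<in> \<Delta>"
  have "card {v i, v (next_index i)} = 2" if "i < n" for i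
    using that next_neq[OF that, symmetric] by (simp add: v_eq_iff)
  then consider "\<sigma> = {}" | i where "i < n" "\<sigma> = {v i}" | "card \<sigma> = 2"
    using \<sigma> unfolding cycle_complex_def by blast
  then show "has_homology_of_sphere TYPE('k) (1 - int (card \<sigma>)) (link \<Delta> \<sigma>)"
  proof cases
    case 1
    then have "link \<Delta> \<sigma> = \<Delta>"
      by (auto simp: link_def)
    then show ?thesis
      using sphere_cycle 1 by simp
  next
    case 2
    obtain p where p: "p < n" "next_index p = i"
      using cycle_predecessor 2 by blast
    then have "v p \<noteq> v (next_index i)"
      using next_next_neq[of p] by (auto simp: v_eq_iff)
    then show ?thesis
      using sphere_two_points[of "v p" "v (next_index i)"] link_vertex[OF p(1)] p 2 by simp
  next
    case 3
    then show ?thesis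
      using sphere_empty_face link_edge \<sigma> by simp
  qed
qed

end

section \<open>One-dimensional homology spheres are cycles\<close>

lemma point_difference_cycle:
  assumes "finite (\<Union>\<Delta>)" "{a} \<in> \<Delta>" "{b} \<in> \<Delta>"
  shows "(\<lambda>xs. point_chain a xs - point_chain b xs :: 'k::field) \<in> cycles \<Delta> 0"
proof -
  let ?c = "\<lambda>xs. point_chain a xs + -1 * point_chain b xs :: 'k"
  have "?c \<in> chains \<Delta> 0"
    using assms by (intro chains_add chains_scale point_chain_in_chains)
  moreover have "boundary \<Delta> ?c = (\<lambda>_. 0)"
    using assms
    by (simp only: boundary_add boundary_scale) (subst (1 2) boundary_point_chain; auto)
  ultimately show ?thesis
    by (simp add: cycles_def)
qed

text \<open>
  The reduced homology of a finite set of points in degree \<open>0\<close> is the space of coefficient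
  functions with sum zero.  With at most one point this space is zero, and with three points
  \<open>a, b, d\<close> the differences \<open>a - b\<close> and \<open>a - d\<close> are linearly independent, so the space is
  one-dimensional only for two points.
\<close>

lemma two_points_if_homology_0_iso:
  fixes \<Gamma> :: "'v set set"
  assumes fin: "finite (\<Union>\<Gamma>)"
    and card: "\<And>\<sigma>. \<sigma> \<in> \<Gamma> \<Longrightarrow> card \<sigma> \<le> 1"
    and iso: "homology_iso_field TYPE('k::field) \<Gamma> 0"
  shows "\<exists>a b. a \<noteq> b \<and> \<Union>\<Gamma> = {a, b}"
proof -
  let ?Z = "cycles \<Gamma> 0 :: ('v list \<Rightarrow> 'k) set"
  have bd: "boundaries \<Gamma> 0 = {\<lambda>_. 0 :: 'k}"
    using card by (intro boundaries_eq_zero) fastforce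
  obtain \<psi> :: "('v list \<Rightarrow> 'k) \<Rightarrow> 'k" where
    add: "\<And>x y. x \<in> ?Z \<Longrightarrow> y \<in> ?Z \<Longrightarrow> \<psi> (\<lambda>xs. x xs + y xs) = \<psi> x + \<psi> y" and
    scale: "\<And>a x. x \<in> ?Z \<Longrightarrow> \<psi> (\<lambda>xs. a * x xs) = a * \<psi> x" and
    surj: "\<psi> ` ?Z = UNIV" and
    ker: "\<And>x. x \<in> ?Z \<Longrightarrow> \<psi> x = 0 \<longleftrightarrow> x = (\<lambda>_. 0)"
    using iso unfolding homology_iso_field_iff bd singleton_iff by blast
  have singleton: "{a} \<in> \<Gamma>" if a: "a \<in> \<Union>\<Gamma>" for a
  proof -
    obtain \<sigma> where \<sigma>: "\<sigma> \<in> \<Gamma>" "a \<in> \<sigma>"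
      using a by blast
    then have "\<sigma> \<subseteq> \<Union>\<Gamma>"
      by blast
    then have "finite \<sigma>"
      using fin by (rule finite_subset)
    then have "\<sigma> = {a}"
      using card[OF \<sigma>(1)] \<sigma>(2) by (auto simp: card_le_Suc0_iff_eq)
    then show ?thesis
      using \<sigma> by simp
  qed
  \<comment> \<open>A nonzero cycle has two points in its support, because its coefficients have sum zero.\<close>
  obtain c where c: "c \<in> ?Z" "\<psi> c = 1"
    using surj by (metis UNIV_I imageE)
  then have "c \<noteq> (\<lambda>_. 0)"
    using ker by fastforce
  then obtain xs where xs: "c xs \<noteq> 0"
    by blast
  have chain: "c \<in> chains \<Gamma> 0"
    using c by (simp add: cycles_def)
  with xs have "length xs = 1" "set xs \<in> \<Gamma>"
    by (auto simp: chains_def)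
  then obtain a where "xs = [a]" "{a} \<in> \<Gamma>"
    by (auto simp: length_Suc_conv)
  then have a: "xs = [a]" "a \<in> \<Union>\<Gamma>"
    by blast+
  have "\<exists>b\<in>\<Union>\<Gamma> - {a}. c [b] \<noteq> 0"
  proof (rule ccontr)
    assume "\<not> ?thesis"
    then have "boundary \<Gamma> c [] = c [a]"
      using sum.remove[OF fin a(2), of "\<lambda>u. c [u]"] by (simp add: boundary_def)
    then show False
      using c xs a by (simp add: cycles_def)
  qed
  then obtain b where b: "b \<in> \<Union>\<Gamma>" "b \<noteq> a"
    by blast
  have "d = a \<or> d = b" if d: "d \<in> \<Union>\<Gamma>" for d
  proof (rule ccontr)
    assume not_ab: "\<not> (d = a \<or> d = b)"
    define x y :: "'v list \<Rightarrow> 'k" where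
      "x = (\<lambda>xs. point_chain a xs - point_chain b xs)" and
      "y = (\<lambda>xs. point_chain a xs - point_chain d xs)"
    have xy: "x \<in> ?Z" "y \<in> ?Z"
      unfolding x_def y_def using a b d by (auto intro!: point_difference_cycle fin singleton)
    \<comment> \<open>Every element of a one-dimensional space is a multiple of any other nonzero one:
      this combination lies in the kernel of \<open>\<psi>\<close>.\<close>
    let ?z = "\<lambda>xs. \<psi> y * x xs + - \<psi> x * y xs"
    have z: "?z \<in> ?Z"
      by (intro cycles_add cycles_scale xy)
    moreover have "\<psi> ?z = 0"
      using add[OF cycles_scale[OF xy(1), of "\<psi> y"] cycles_scale[OF xy(2), of "- \<psi> x"]]
      by (simp only: scale xy) simp
    ultimately have "?z = (\<lambda>_. 0)"
      using ker by blast
    then have "?z [b] = 0"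
      by (rule fun_cong)
    then have "\<psi> y = 0"
      using b not_ab by (auto simp: x_def y_def point_chain_def)
    then have "y = (\<lambda>_. 0)"
      using ker xy by blast
    then have "y [d] = 0"
      by simp
    then show False
      using not_ab by (simp add: y_def point_chain_def)
  qed
  then have "\<Union>\<Gamma> = {a, b}"
    using a b by blast
  then show ?thesis
    using b by blast
qed

text \<open>
  The terms cancel in pairs.  The diagonal is a separate hypothesis because antisymmetry does not
  make it vanish over a field of characteristic \<open>2\<close>.
\<close>

lemma sum_antisymmetric_eq_zero:
  fixes d :: "'v \<Rightarrow> 'v \<Rightarrow> 'k::field"
  assumes "finite S" and swap: "\<And>u w. d u w = - d w u" and diag: "\<And>u. d u u = 0"
  shows "(\<Sum>w\<in>S. \<Sum>u\<in>S. d u w) = 0"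
  using \<open>finite S\<close>
proof induction
  case (insert a S)
  have "(\<Sum>w\<in>S. d a w) = - (\<Sum>u\<in>S. d u a)"
    using swap[of a] by (simp add: sum_negf)
  then show ?case
    using insert by (simp add: sum.distrib diag)
qed simp

text \<open>
  Vanishing homology in degree \<open>0\<close> gives connectedness.  If \<open>w\<close> lay outside the closed set \<open>S\<close>,
  then \<open>a - w\<close> would be a boundary.  The coefficients of \<open>a - w\<close> on \<open>S\<close> have sum \<open>1\<close>, but those of
  a boundary have sum \<open>0\<close>: no edge leaves \<open>S\<close>, and an edge inside \<open>S\<close> contributes its coefficient
  once with each sign.
\<close>

lemma closed_set_is_everything_if_homology_0_trivial:
  fixes \<Delta> :: "'v set set"
  assumes fin: "finite (\<Union>\<Delta>)"
    and singleton: "\<And>a. a \<in> \<Union>\<Delta> \<Longrightarrow> {a} \<in> \<Delta>"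
    and triv: "homology_trivial TYPE('k::field) \<Delta> 0"
    and S: "S \<subseteq> \<Union>\<Delta>" "a \<in> S"
    and closed: "\<And>s u. s \<in> S \<Longrightarrow> {u, s} \<in> \<Delta> \<Longrightarrow> u \<in> S"
  shows "S = \<Union>\<Delta>"
proof (rule ccontr)
  assume "S \<noteq> \<Union>\<Delta>"
  then obtain w where w: "w \<in> \<Union>\<Delta>" "w \<notin> S"
    using S by blast
  let ?c = "\<lambda>xs. point_chain a xs - point_chain w xs :: 'k"
  have "?c \<in> cycles \<Delta> 0"
    using w S by (intro point_difference_cycle fin singleton) auto
  then have "?c \<in> boundaries \<Delta> 0"
    using triv by (auto simp: homology_trivial_iff)
  then obtain d where d: "d \<in> chains \<Delta> 1" "?c = boundary \<Delta> d"
    by (auto simp: boundaries_def)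
  have coeff: "?c [s] = (\<Sum>u\<in>\<Union>\<Delta>. d [u, s])" for s
    using fun_cong[OF d(2), of "[s]"] by (simp add: boundary_def)
  have finS: "finite S"
    using S fin finite_subset by blast
  have "(\<Sum>s\<in>S. ?c [s]) = (\<Sum>s\<in>S. if s = a then 1 else 0)"
    using w by (intro sum.cong) (auto simp: point_chain_def)
  then have "1 = (\<Sum>s\<in>S. ?c [s])"
    using S finS by simp
  also have "\<dots> = (\<Sum>s\<in>S. \<Sum>u\<in>\<Union>\<Delta>. d [u, s])"
    by (intro sum.cong refl coeff)
  also have "\<dots> = (\<Sum>s\<in>S. \<Sum>u\<in>S. d [u, s])"
  proof (rule sum.cong[OF refl])
    fix s
    assume "s \<in> S"
    then have "d [u, s] = 0" if "u \<notin> S" for u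
      using closed[of s u] d(1) that by (force simp: chains_def)
    then show "(\<Sum>u\<in>\<Union>\<Delta>. d [u, s]) = (\<Sum>u\<in>S. d [u, s])"
      using fin S(1) by (intro sum.mono_neutral_right) auto
  qed
  also have "\<dots> = 0"
  proof (rule sum_antisymmetric_eq_zero[OF finS])
    show "d [u, s] = - d [s, u]" for u s
      by (rule chains_swap[OF d(1)])
    show "d [u, u] = 0" for u
      using d(1) by (force simp: chains_def)
  qed
  finally show False
    by simp
qed

text \<open>
  A longest path closes up.  Both neighbours of its first vertex lie on the path, since otherwise
  the path could be extended at its start.  One of them is therefore \<open>v l\<close> with \<open>l \<ge> 2\<close>, and \<open>l\<close> is
  the last index, because \<open>v l\<close> would otherwise have the three neighbours \<open>v 0\<close>, \<open>v (l - 1)\<close> and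
  \<open>v (l + 1)\<close>.
\<close>

lemma two_regular_contains_cycle:
  assumes fin: "finite V" and "V \<noteq> {}"
    and sym: "\<And>x y. E x y \<Longrightarrow> E y x" and irrefl: "\<And>x. \<not> E x x"
    and two: "\<And>x. x \<in> V \<Longrightarrow> \<exists>a b. a \<noteq> b \<and> a \<in> V \<and> b \<in> V \<and> (\<forall>w. E x w \<longleftrightarrow> w = a \<or> w = b)"
  obtains n v where "n \<ge> 3" "inj_on v {..<n}" "v ` {..<n} \<subseteq> V"
    "\<forall>i<n. \<forall>w. E (v (Suc i mod n)) w \<longleftrightarrow> w = v i \<or> w = v (Suc (Suc i mod n) mod n)"
proof -
  define path where "path xs \<longleftrightarrow> xs \<noteq> [] \<and> distinct xs \<and> set xs \<subseteq> V \<and>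
    (\<forall>i. Suc i < length xs \<longrightarrow> E (xs ! i) (xs ! Suc i))" for xs
  obtain x where "x \<in> V"
    using \<open>V \<noteq> {}\<close> by blast
  then have "path [x]"
    by (simp add: path_def)
  moreover have "length xs < Suc (card V)" if "path xs" for xs
    using that card_mono[OF fin, of "set xs"] by (simp add: path_def distinct_card)
  ultimately obtain xs where xs: "path xs" and max: "\<And>ys. path ys \<Longrightarrow> length ys \<le> length xs"
    using ex_has_greatest_nat[of path "[x]" length "Suc (card V)"] by (metis less_imp_le)
  define n where "n = length xs"
  define v where "v = (!) xs"
  have inj: "inj_on v {..<n}"
    using xs by (auto simp: v_def n_def path_def inj_on_nth)
  have eq_iff: "v i = v j \<longleftrightarrow> i = j" if "i < n" "j < n" for i j
    using inj_on_eq_iff[OF inj] that by simp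
  have inV: "v i \<in> V" if "i < n" for i
    using xs that by (auto simp: v_def n_def path_def)
  have step: "E (v i) (v (Suc i))" if "Suc i < n" for i
    using xs that by (simp add: v_def n_def path_def)
  have "n > 0"
    using xs by (simp add: n_def path_def)
  have at_most_two: "card (v ` J) \<le> 2" if "i < n" "\<And>j. j \<in> J \<Longrightarrow> E (v i) (v j)" for i J
  proof -
    obtain a b where "\<forall>w. E (v i) w \<longleftrightarrow> w = a \<or> w = b"
      using two[OF inV[OF \<open>i < n\<close>]] by blast
    then have "v ` J \<subseteq> {a, b}"
      using that by blast
    then have "card (v ` J) \<le> card {a, b}"
      by (intro card_mono) auto
    also have "\<dots> \<le> 2"
      by (simp add: card_insert_if)
    finally show ?thesis .
  qed
  have on_path: "\<exists>j<n. j > 0 \<and> w = v j" if "E (v 0) w" "w \<in> V" for w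
  proof -
    have "w \<in> set xs"
    proof (rule ccontr)
      assume "w \<notin> set xs"
      then have "path (w # xs)"
        using xs sym[OF that(1)] that(2) unfolding path_def v_def
        by (auto simp: nth_Cons split: nat.split)
      then show False
        using max by fastforce
    qed
    then obtain j where "j < n" "w = v j"
      by (auto simp: in_set_conv_nth v_def n_def)
    then show ?thesis
      using that irrefl by (cases "j = 0") auto
  qed
  obtain a b where ab: "a \<noteq> b" "a \<in> V" "b \<in> V" "E (v 0) a" "E (v 0) b"
    using two[OF inV[OF \<open>n > 0\<close>]] by blast
  obtain j where j: "j < n" "j > 0" "a = v j"
    using on_path[OF ab(4,2)] by blast
  obtain k where k: "k < n" "k > 0" "b = v k"
    using on_path[OF ab(5,3)] by blast
  \<comment> \<open>Both positions are positive and distinct, so the larger one is at least \<open>2\<close>.\<close>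
  define l where "l = max j k"
  have "j \<noteq> k"
    using ab(1) j k by blast
  then have l: "l \<ge> 2" "l < n" "E (v 0) (v l)"
    using j k ab(4,5) by (auto simp: l_def max_def)
  have "Suc l = n"
  proof (rule ccontr)
    assume "Suc l \<noteq> n"
    let ?J = "{0, l - 1, Suc l}"
    have "card (v ` ?J) \<le> 2"
      using l \<open>Suc l \<noteq> n\<close> sym[OF l(3)] step[of l] sym[OF step[of "l - 1"]]
      by (intro at_most_two[of l]) auto
    moreover have "card (v ` ?J) = 3"
      using l \<open>Suc l \<noteq> n\<close> by (simp add: eq_iff)
    ultimately show False
      by simp
  qed
  then have n3: "n \<ge> 3"
    using l by simp
  interpret embedded_cycle n v
    by standard (fact n3 inj)+
  have succ: "E (v i) (v (next_index i))" if "i < n" for i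
    using that step[of i] sym[OF l(3)] \<open>Suc l = n\<close> by (cases "Suc i = n") auto
  have "E (v (next_index i)) w \<longleftrightarrow> w = v i \<or> w = v (next_index (next_index i))" if "i < n" for i w
  proof -
    obtain a b where ab: "\<forall>w. E (v (next_index i)) w \<longleftrightarrow> w = a \<or> w = b"
      using two[OF inV[OF next_lt]] by blast
    moreover have "E (v (next_index i)) (v i)" "E (v (next_index i)) (v (next_index (next_index i)))"
      using succ[OF that] succ[OF next_lt] sym by blast+
    moreover have "v i \<noteq> v (next_index (next_index i))"
      using next_next_neq[OF that] that by (simp add: v_eq_iff)
    ultimately show ?thesis
      by metis
  qed
  then show ?thesis
    using n3 inj inV by (intro that[of n v]) auto
qed

text \<open>
  The vertex links make the graph two-regular, so it contains a cycle that already has all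
  neighbours of its vertices; by connectedness this cycle is the whole complex.
\<close>

lemma cycle_complex_if_homology_sphere:
  fixes \<Delta> :: "'v set set"
  assumes sphere: "homology_sphere TYPE('k::field) 1 \<Delta>"
  shows "\<exists>n v. n \<ge> 3 \<and> inj_on v {..<n} \<and> \<Delta> = cycle_complex n v"
proof -
  have complex: "finite \<Delta>" "{} \<in> \<Delta>" "\<And>\<sigma>. \<sigma> \<in> \<Delta> \<Longrightarrow> finite \<sigma>"
    and sub: "\<And>\<sigma> \<tau>. \<sigma> \<in> \<Delta> \<Longrightarrow> \<tau> \<subseteq> \<sigma> \<Longrightarrow> \<tau> \<in> \<Delta>"
    and dim: "complex_dim \<Delta> = 1"
    and links: "\<And>\<sigma>. \<sigma> \<in> \<Delta> \<Longrightarrow> has_homology_of_sphere TYPE('k) (1 - int (card \<sigma>)) (link \<Delta> \<sigma>)"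
    using sphere unfolding homology_sphere_def finite_simplicial_complex_def by blast+
  have Max: "Max (card ` \<Delta>) = 2"
    using dim by (simp add: complex_dim_def)
  then have card: "card \<sigma> \<le> 2" if "\<sigma> \<in> \<Delta>" for \<sigma>
    using that complex(1) Max_ge[of "card ` \<Delta>" "card \<sigma>"] by simp
  have "2 \<in> card ` \<Delta>"
    using Max_in[of "card ` \<Delta>"] complex unfolding Max by blast
  then have nonempty: "\<Union>\<Delta> \<noteq> {}"
    by force
  have fin: "finite (\<Union>\<Delta>)"
    using complex by blast
  have singleton: "{a} \<in> \<Delta>" if "a \<in> \<Union>\<Delta>" for a
    using that sub by blast
  define E where "E x y \<longleftrightarrow> x \<noteq> y \<and> {x, y} \<in> \<Delta>" for x y
  have two: "\<exists>a b. a \<noteq> b \<and> a \<in> \<Union>\<Delta> \<and> b \<in> \<Union>\<Delta> \<and> (\<forall>w. E x w \<longleftrightarrow> w = a \<or> w = b)"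
    if x: "x \<in> \<Union>\<Delta>" for x
  proof -
    have fin_link: "finite (\<Union>(link \<Delta> {x}))"
      using fin by (rule rev_finite_subset) (auto simp: link_def)
    have card_link: "card \<sigma> \<le> 1" if "\<sigma> \<in> link \<Delta> {x}" for \<sigma>
      using that card[of "insert x \<sigma>"] complex(3)[of \<sigma>] by (auto simp: link_def)
    have "homology_iso_field TYPE('k) (link \<Delta> {x}) 0"
      using links[OF singleton[OF x]] by (simp add: has_homology_of_sphere_def)
    then obtain a b where "a \<noteq> b" "\<Union>(link \<Delta> {x}) = {a, b}"
      using two_points_if_homology_0_iso[OF fin_link card_link] by blast
    moreover have "w \<in> \<Union>(link \<Delta> {x}) \<longleftrightarrow> E x w" for w
    proof
      assume "w \<in> \<Union>(link \<Delta> {x})"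
      then obtain \<tau> where "w \<in> \<tau>" "\<tau> \<union> {x} \<in> \<Delta>" "x \<notin> \<tau>"
        by (auto simp: link_def)
      then show "E x w"
        using sub[of "\<tau> \<union> {x}" "{x, w}"] by (auto simp: E_def)
    next
      assume "E x w"
      then have "{w} \<in> link \<Delta> {x}"
        using sub[of "{x, w}" "{w}"] by (auto simp: link_def E_def insert_commute)
      then show "w \<in> \<Union>(link \<Delta> {x})"
        by blast
    qed
    ultimately have "\<forall>w. E x w \<longleftrightarrow> w = a \<or> w = b"
      by auto
    moreover have "a \<in> \<Union>\<Delta>" "b \<in> \<Union>\<Delta>"
      using \<open>\<Union>(link \<Delta> {x}) = {a, b}\<close> by (auto simp: link_def)
    ultimately show ?thesis
      using \<open>a \<noteq> b\<close> by blast
  qed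
  have E_sym_irrefl: "E x y \<Longrightarrow> E y x" "\<not> E x x" for x y
    by (auto simp: E_def insert_commute)
  obtain n v where n: "n \<ge> 3" and inj: "inj_on v {..<n}" and V: "v ` {..<n} \<subseteq> \<Union>\<Delta>"
    and neighbours:
      "\<forall>i<n. \<forall>w. E (v (Suc i mod n)) w \<longleftrightarrow> w = v i \<or> w = v (Suc (Suc i mod n) mod n)"
    by (rule two_regular_contains_cycle[OF fin nonempty E_sym_irrefl two])
  note nbr = neighbours[rule_format]
  interpret C: embedded_cycle n v
    by standard (fact n inj)+
  have nbr_on_cycle: "w \<in> v ` {..<n}" "{x, w} \<in> cycle_complex n v"
    if xw: "x \<in> v ` {..<n}" "E x w" for x w
  proof -
    obtain j where "j < n" "x = v j"
      using xw(1) by blast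
    moreover then obtain p where p: "p < n" "Suc p mod n = j"
      using cycle_predecessor by blast
    ultimately have "w = v p \<or> w = v (Suc j mod n)"
      using nbr[OF p(1)] xw(2) by simp
    then show "w \<in> v ` {..<n}" "{x, w} \<in> cycle_complex n v"
      using p \<open>j < n\<close> \<open>x = v j\<close> C.edge_face[of p] C.edge_face[of j]
      by (auto simp: insert_commute)
  qed
  have "homology_trivial TYPE('k) (link \<Delta> {}) 0"
    using links[OF complex(2)] by (simp add: has_homology_of_sphere_def)
  moreover have "link \<Delta> {} = \<Delta>"
    by (auto simp: link_def)
  ultimately have triv: "homology_trivial TYPE('k) \<Delta> 0"
    by simp
  have all: "v ` {..<n} = \<Union>\<Delta>"
  proof (rule closed_set_is_everything_if_homology_0_trivial[OF fin singleton triv V])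
    show "v 0 \<in> v ` {..<n}"
      using n by simp
    show "u \<in> v ` {..<n}" if "s \<in> v ` {..<n}" "{u, s} \<in> \<Delta>" for s u
      using that nbr_on_cycle(1)[of s u] by (cases "u = s") (auto simp: E_def insert_commute)
  qed
  have "\<Delta> = cycle_complex n v"
  proof
    show "\<Delta> \<subseteq> cycle_complex n v"
    proof
      fix \<sigma>
      assume \<sigma>: "\<sigma> \<in> \<Delta>"
      then consider "card \<sigma> = 0" | "card \<sigma> = 1" | "card \<sigma> = 2"
        using card[OF \<sigma>] by linarith
      then show "\<sigma> \<in> cycle_complex n v"
      proof cases
        case 1
        then show ?thesis
          using complex(3)[OF \<sigma>] C.empty_face by simp
      next
        case 2
        then obtain x where "\<sigma> = {x}"
          by (auto simp: card_1_singleton_iff)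
        moreover then have "x \<in> v ` {..<n}"
          using \<sigma> unfolding all by blast
        ultimately show ?thesis
          using C.vertex_face by blast
      next
        case 3
        then obtain x y where xy: "\<sigma> = {x, y}" "x \<noteq> y"
          by (auto simp: card_2_iff)
        then have "x \<in> v ` {..<n}" "E x y"
          using \<sigma> unfolding all E_def by blast+
        then show ?thesis
          using nbr_on_cycle(2) xy by simp
      qed
    qed
    have "{v i, v (Suc i mod n)} \<in> \<Delta>" if "i < n" for i
      using nbr[OF that, of "v i"] by (simp add: E_def insert_commute)
    moreover have "{v i} \<in> \<Delta>" if "i < n" for i
      using singleton V that by blast
    ultimately show "cycle_complex n v \<subseteq> \<Delta>"
      using complex(2) by (auto simp: cycle_complex_def)
  qed
  then show ?thesis
    using n inj by blast
qed

theorem homology_sphere_1_iff: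
  "homology_sphere TYPE('k::field) 1 \<Delta> \<longleftrightarrow>
    (\<exists>n v. n \<ge> 3 \<and> inj_on v {..<n} \<and> \<Delta> = cycle_complex n v)"
  using cycle_complex_if_homology_sphere embedded_cycle.homology_sphere_cycle
  by (auto simp: embedded_cycle_def)

section \<open>Matching complexes that are cycles\<close>

lemma cycle_complex_image: "cycle_complex n v = (`) v ` cycle_complex n id"
  by (auto simp: cycle_complex_def image_Un image_image)

lemma graph_complex_cycle_graph: "graph_complex (cycle_graph n) = cycle_complex n id"
  by (auto simp: graph_complex_def cycle_graph_def cycle_complex_def)

lemma complex_iso_cycle_graph_iff:
  "complex_iso \<Delta> (graph_complex (cycle_graph n)) \<longleftrightarrow>
    (\<exists>v. inj_on v {..<n} \<and> \<Delta> = cycle_complex n v)"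
  unfolding graph_complex_cycle_graph
proof
  assume "complex_iso \<Delta> (cycle_complex n id)"
  then obtain f where f: "bij_betw f (\<Union>\<Delta>) {..<n}" "(`) f ` \<Delta> = cycle_complex n id"
    by (auto simp: complex_iso_def Union_cycle_complex)
  let ?v = "inv_into (\<Union>\<Delta>) f"
  have "?v ` f ` \<sigma> = \<sigma>" if "\<sigma> \<in> \<Delta>" for \<sigma>
    using that by (intro inv_into_image_cancel bij_betw_imp_inj_on[OF f(1)]) blast
  then have "\<Delta> = (`) ?v ` (`) f ` \<Delta>"
    by (simp add: image_image)
  then have "\<Delta> = cycle_complex n ?v"
    unfolding f(2) by (simp flip: cycle_complex_image)
  moreover have "inj_on ?v {..<n}"
    using bij_betw_inv_into[OF f(1)] by (rule bij_betw_imp_inj_on)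
  ultimately show "\<exists>v. inj_on v {..<n} \<and> \<Delta> = cycle_complex n v"
    by blast
next
  assume "\<exists>v. inj_on v {..<n} \<and> \<Delta> = cycle_complex n v"
  then obtain v where v: "inj_on v {..<n}" "\<Delta> = cycle_complex n v"
    by blast
  let ?f = "inv_into {..<n} v"
  have "bij_betw ?f (\<Union>\<Delta>) {..<n}"
    using v by (auto simp: Union_cycle_complex intro: bij_betw_inv_into inj_on_imp_bij_betw)
  moreover have "?f ` v ` \<sigma> = \<sigma>" if "\<sigma> \<in> cycle_complex n id" for \<sigma>
  proof (rule inv_into_image_cancel[OF v(1)])
    show "\<sigma> \<subseteq> {..<n}"
      using that Union_cycle_complex[of n id] by auto
  qed
  then have "(`) ?f ` \<Delta> = cycle_complex n id"
    unfolding v(2) cycle_complex_image[of n v] by (simp add: image_image)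
  ultimately show "complex_iso \<Delta> (cycle_complex n id)"
    unfolding complex_iso_def by (intro exI[of _ ?f]) (simp add: Union_cycle_complex)
qed

text \<open>
  For \<open>n \<ge> 4\<close> this is equivalent to \<open>M(G)\<close> being the cycle through \<open>e\<close>.  It speaks only of pairs
  of edges of \<open>G\<close>, and so can be checked on an explicit list and carried along isomorphisms.
\<close>

definition cyclic_edges :: "'a graph \<Rightarrow> nat \<Rightarrow> (nat \<Rightarrow> 'a set) \<Rightarrow> bool" where
  "cyclic_edges G n e \<longleftrightarrow> inj_on e {..<n} \<and> edges G = e ` {..<n} \<and>
    (\<forall>i<n. \<forall>j<n. i \<noteq> j \<longrightarrow> (disjnt (e i) (e j) \<longleftrightarrow> j = Suc i mod n \<or> i = Suc j mod n))"

lemma Union_matching_complex: "\<Union>(matching_complex G) = edges G"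
proof -
  have "{x} \<in> matching_complex G" if "x \<in> edges G" for x
    using that by (simp add: matching_complex_def matching_def)
  then have "edges G \<subseteq> \<Union>(matching_complex G)"
    by blast
  moreover have "\<Union>(matching_complex G) \<subseteq> edges G"
    by (auto simp: matching_complex_def matching_def)
  ultimately show ?thesis
    by blast
qed

lemma cyclic_edges_if_matching_complex:
  assumes inj: "inj_on e {..<n}" and M: "matching_complex G = cycle_complex n e"
  shows "cyclic_edges G n e"
proof -
  have E: "edges G = e ` {..<n}"
    using Union_matching_complex[of G] by (simp add: M Union_cycle_complex)
  moreover have "disjnt (e i) (e j) \<longleftrightarrow> j = Suc i mod n \<or> i = Suc j mod n"
    if ij: "i < n" "j < n" "i \<noteq> j" for i j
  proof -
    have "e i \<noteq> e j"
      using ij inj by (simp add: inj_on_eq_iff)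
    then have "disjnt (e i) (e j) \<longleftrightarrow> {e i, e j} \<in> matching_complex G"
      using ij E by (auto simp: matching_complex_def matching_def pairwise_def disjnt_sym)
    then show ?thesis
      unfolding M using edge_in_cycle_complex_iff[OF inj ij] by simp
  qed
  ultimately show ?thesis
    using inj by (simp add: cyclic_edges_def)
qed

text \<open>
  A cycle of length at least four contains no triangle: the second neighbours of two consecutive
  vertices \<open>k\<close> and \<open>k + 1\<close> are \<open>k - 1\<close> and \<open>k + 2\<close>, which differ modulo \<open>n\<close> unless \<open>n\<close> divides
  \<open>3\<close>.
\<close>

lemma clique_in_cycle:
  assumes n: "n \<ge> 4" and I: "I \<subseteq> {..<n}" "I \<noteq> {}"
    and adj: "\<And>i j. i \<in> I \<Longrightarrow> j \<in> I \<Longrightarrow> i \<noteq> j \<Longrightarrow> j = Suc i mod n \<or> i = Suc j mod n"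
  shows "\<exists>i<n. I = {i} \<or> I = {i, Suc i mod n}"
proof (cases "\<exists>i. I = {i}")
  case False
  with I obtain i j where ij: "i \<in> I" "j \<in> I" "i \<noteq> j"
    by blast
  then obtain k where k: "k \<in> I" "Suc k mod n \<in> I" "k < n"
    using adj[OF ij] I by auto
  have "l = k \<or> l = Suc k mod n" if l: "l \<in> I" for l
    using adj[OF l k(1)] adj[OF l k(2)] l k n I(1)
    by (auto simp: Suc_mod_less subset_iff split: if_splits)
  then show ?thesis
    using k by blast
qed (use I in auto)

text \<open>
  A matching is a set of pairwise consecutive edges, so by \<open>clique_in_cycle\<close> it has at most two
  elements; this is where \<open>n \<ge> 4\<close> is needed.
\<close>

lemma matching_complex_if_cyclic_edges:
  assumes n: "n \<ge> 4" and cyc: "cyclic_edges G n e"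
  shows "matching_complex G = cycle_complex n e"
proof
  have inj: "inj_on e {..<n}" and E: "edges G = e ` {..<n}"
    and adj: "\<And>i j. i < n \<Longrightarrow> j < n \<Longrightarrow> i \<noteq> j \<Longrightarrow>
      disjnt (e i) (e j) \<longleftrightarrow> j = Suc i mod n \<or> i = Suc j mod n"
    using cyc by (auto simp: cyclic_edges_def)
  show "matching_complex G \<subseteq> cycle_complex n e"
  proof
    fix M
    assume "M \<in> matching_complex G"
    then have M: "M \<subseteq> e ` {..<n}" "pairwise disjnt M"
      by (auto simp: matching_complex_def matching_def E)
    then obtain I where I: "I \<subseteq> {..<n}" "M = e ` I"
      by (auto simp: subset_image_iff)
    have "j = Suc i mod n \<or> i = Suc j mod n" if "i \<in> I" "j \<in> I" "i \<noteq> j" for i j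
    proof -
      have "i < n" "j < n"
        using that I by auto
      moreover have "e i \<noteq> e j"
        using calculation that inj by (simp add: inj_on_eq_iff)
      then have "disjnt (e i) (e j)"
        using M(2) that by (simp add: I(2) pairwise_def)
      ultimately show ?thesis
        using adj that by blast
    qed
    then have "I = {} \<or> (\<exists>i<n. I = {i} \<or> I = {i, Suc i mod n})"
      using clique_in_cycle[OF n I(1)] by blast
    then show "M \<in> cycle_complex n e"
      unfolding I(2) by (auto simp: cycle_complex_def)
  qed
  have "disjnt (e i) (e (Suc i mod n))" if "i < n" for i
    using that n adj[of i "Suc i mod n"] by (auto simp: Suc_mod_less split: if_splits)
  then have "{e i, e (Suc i mod n)} \<in> matching_complex G" if "i < n" for i
    using that n
    by (auto simp: matching_complex_def matching_def E pairwise_insert disjnt_sym)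
  moreover have "{e i} \<in> matching_complex G" if "i < n" for i
    using that by (simp add: matching_complex_def matching_def E)
  moreover have "{} \<in> matching_complex G"
    by (simp add: matching_complex_def matching_def)
  ultimately show "cycle_complex n e \<subseteq> matching_complex G"
    by (auto simp: cycle_complex_def)
qed

lemma complex_iso_matching_complex_iff:
  assumes "n \<ge> 4"
  shows "complex_iso (matching_complex G) (graph_complex (cycle_graph n)) \<longleftrightarrow>
    (\<exists>e. cyclic_edges G n e)"
  unfolding complex_iso_cycle_graph_iff
  using cyclic_edges_if_matching_complex matching_complex_if_cyclic_edges[OF assms]
  by (metis cyclic_edges_def)

lemma card_edge: "finite_simple_graph G \<Longrightarrow> cyclic_edges G n e \<Longrightarrow> i < n \<Longrightarrow> card (e i) = 2"
  by (auto simp: finite_simple_graph_def cyclic_edges_def)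

text \<open>
  The three edges would be pairwise disjoint, and the matching complex would also contain the
  triangle that they span.
\<close>

lemma matching_complex_not_triangle:
  assumes "inj_on e {..<3}" "matching_complex G = cycle_complex 3 e"
  shows False
proof -
  have cyc: "cyclic_edges G 3 e"
    using assms by (rule cyclic_edges_if_matching_complex)
  have "disjnt (e i) (e j)" if "i < 3" "j < 3" "i \<noteq> j" for i j
  proof -
    have "j = Suc i mod 3 \<or> i = Suc j mod 3"
      using that by (auto simp: Suc_mod_less)
    then show ?thesis
      using cyc that unfolding cyclic_edges_def by blast
  qed
  then have "pairwise disjnt (e ` {..<3})"
    by (auto simp: pairwise_def)
  then have "e ` {..<3} \<in> cycle_complex 3 e"
    using cyc unfolding assms(2)[symmetric]
    by (simp add: matching_complex_def matching_def cyclic_edges_def)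
  then have "card (e ` {..<3}) \<le> 2"
    using card_face_cycle_complex by blast
  then show False
    using assms(1) by (simp add: card_image)
qed

lemma edge_meeting_both_sides:
  assumes "card f = 2" "disjnt x y" "\<not> disjnt f x" "\<not> disjnt f y"
  shows "f \<subseteq> x \<union> y"
proof -
  obtain p q where "p \<in> f" "p \<in> x" "q \<in> f" "q \<in> y"
    using assms by (auto simp: disjnt_def)
  moreover then have "f = {p, q}"
    using assms by (auto simp: card_2_iff disjnt_def)
  ultimately show ?thesis
    by blast
qed

text \<open>
  For \<open>n \<ge> 7\<close>, the indices \<open>3, 4, 5\<close> are not cyclic neighbours of \<open>0\<close> or \<open>1\<close>.  Hence
  \<open>e 3, e 4, e 5\<close> lie inside the four-element set \<open>e 0 \<union> e 1\<close>, and both \<open>e 3\<close> and \<open>e 5\<close> have to be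
  the complement of \<open>e 4\<close> there.
\<close>

lemma cyclic_edges_le_6:
  assumes G: "finite_simple_graph G" and cyc: "cyclic_edges G n e"
  shows "n \<le> 6"
proof (rule ccontr)
  assume "\<not> n \<le> 6"
  then have n: "n \<ge> 7"
    by simp
  note card = card_edge[OF G cyc]
  have adj: "disjnt (e i) (e j) \<longleftrightarrow> j = Suc i mod n \<or> i = Suc j mod n"
    if "i < n" "j < n" "i \<noteq> j" for i j
    using cyc that by (simp add: cyclic_edges_def)
  have disj: "disjnt (e 0) (e 1)" "disjnt (e 3) (e 4)" "disjnt (e 5) (e 4)"
    using n by (simp_all add: adj)
  let ?W = "e 0 \<union> e 1"
  have fin: "finite (e i)" if "i < n" for i
    using card[OF that] card.infinite by fastforce
  have cross: "e i \<subseteq> ?W" if "i \<in> {3, 4, 5}" for i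
    using that n
    by (intro edge_meeting_both_sides card disj(1)) (auto simp: adj)
  have finW: "finite ?W"
    using n fin by simp
  have cardW: "card ?W = 4"
    using n card fin disj(1) by (subst card_Un_disjoint) (auto simp: disjnt_def)
  have "e i = ?W - e 4" if i: "i \<in> {3, 5}" for i
  proof (rule card_subset_eq)
    show "e i \<subseteq> ?W - e 4"
      using i cross[of i] disj by (auto simp: disjnt_def)
    have "card (?W - e 4) = card ?W - card (e 4)"
      using cross[of 4] n fin by (intro card_Diff_subset) auto
    then show "card (e i) = card (?W - e 4)"
      using i n card[of 4] card[of i] cardW by auto
  qed (use finW in simp)
  then have "e 3 = e 5"
    by simp
  then show False
    using cyc n inj_on_eq_iff[of e "{..<n}" 3 5] by (simp add: cyclic_edges_def)
qed

text \<open>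
  Between simple graphs without isolated vertices such a map is an isomorphism
  (\<open>graph_iso_iff_edge_embedding\<close>), but it only has to be checked on a list of edges.
\<close>

definition edge_embedding :: "('a \<Rightarrow> 'b) \<Rightarrow> 'a graph \<Rightarrow> 'b graph \<Rightarrow> bool" where
  "edge_embedding g H G \<longleftrightarrow> inj_on g (verts H) \<and> edges G = (`) g ` edges H"

lemma simple_edgeE:
  assumes "finite_simple_graph G" "e \<in> edges G"
  obtains u w where "u \<in> verts G" "w \<in> verts G" "e = {u, w}"
  using assms by (fastforce simp: finite_simple_graph_def card_2_iff)

lemma graph_iso_iff_edge_embedding:
  assumes G: "finite_simple_graph G" "no_isolated_verts G"
    and H: "finite_simple_graph H" "no_isolated_verts H"
  shows "graph_iso G H \<longleftrightarrow> (\<exists>g. edge_embedding g H G)"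
proof
  assume "graph_iso G H"
  then obtain f where f: "bij_betw f (verts G) (verts H)"
    and edge: "\<And>u w. u \<in> verts G \<Longrightarrow> w \<in> verts G \<Longrightarrow>
      {u, w} \<in> edges G \<longleftrightarrow> {f u, f w} \<in> edges H"
    by (auto simp: graph_iso_def)
  let ?g = "inv_into (verts G) f"
  have g: "?g (f u) = u" if "u \<in> verts G" for u
    using that f by (simp add: bij_betw_def)
  have "edges G = (`) ?g ` edges H"
  proof (intro equalityI subsetI)
    fix e
    assume "e \<in> edges G"
    moreover then obtain u w where uw: "u \<in> verts G" "w \<in> verts G" "e = {u, w}"
      using simple_edgeE[OF G(1)] by blast
    ultimately have "{f u, f w} \<in> edges H" "e = ?g ` {f u, f w}"
      using edge by (simp_all add: g)
    then show "e \<in> (`) ?g ` edges H"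
      by blast
  next
    fix e
    assume "e \<in> (`) ?g ` edges H"
    then obtain e' where e': "e' \<in> edges H" "e = ?g ` e'"
      by blast
    then obtain x y where xy: "x \<in> verts H" "y \<in> verts H" "e' = {x, y}"
      using simple_edgeE[OF H(1)] by blast
    then obtain u w where "u \<in> verts G" "x = f u" "w \<in> verts G" "y = f w"
      using bij_betw_imp_surj_on[OF f] by (metis imageE)
    then show "e \<in> edges G"
      using e' xy edge by (simp add: g)
  qed
  moreover have "inj_on ?g (verts H)"
    using bij_betw_inv_into[OF f] by (rule bij_betw_imp_inj_on)
  ultimately show "\<exists>g. edge_embedding g H G"
    by (auto simp: edge_embedding_def)
next
  assume "\<exists>g. edge_embedding g H G"
  then obtain g where inj: "inj_on g (verts H)" and E: "edges G = (`) g ` edges H"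
    by (auto simp: edge_embedding_def)
  have "verts G = \<Union>(edges G)" "verts H = \<Union>(edges H)"
    using G H by (auto simp: finite_simple_graph_def no_isolated_verts_def)
  then have V: "verts G = g ` verts H"
    by (simp add: E image_Union)
  let ?f = "inv_into (verts H) g"
  have "bij_betw g (verts H) (verts G)"
    using inj V by (simp add: bij_betw_def)
  then have "bij_betw ?f (verts G) (verts H)"
    by (rule bij_betw_inv_into)
  moreover have "{g x, g y} \<in> edges G \<longleftrightarrow> {x, y} \<in> edges H" if "x \<in> verts H" "y \<in> verts H" for x y
  proof
    assume "{g x, g y} \<in> edges G"
    then obtain e where e: "e \<in> edges H" "g ` {x, y} = g ` e"
      by (auto simp: E)
    then have "e \<subseteq> verts H"
      using H by (auto simp: finite_simple_graph_def)
    then have "{x, y} = e"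
      using inj_on_image_eq_iff[OF inj, of "{x, y}" e] e that by blast
    then show "{x, y} \<in> edges H"
      using e by simp
  next
    assume "{x, y} \<in> edges H"
    then have "g ` {x, y} \<in> edges G"
      unfolding E by (rule imageI)
    then show "{g x, g y} \<in> edges G"
      by simp
  qed
  then have "{u, w} \<in> edges G \<longleftrightarrow> {?f u, ?f w} \<in> edges H" if "u \<in> verts G" "w \<in> verts G" for u w
    using that inj by (auto simp: V)
  ultimately show "graph_iso G H"
    by (auto simp: graph_iso_def)
qed

lemma cyclic_edges_transfer:
  assumes H: "finite_simple_graph H" and cyc: "cyclic_edges H n h" and g: "edge_embedding g H G"
  shows "cyclic_edges G n (\<lambda>i. g ` h i)"
proof -
  have sub: "h i \<subseteq> verts H" if "i < n" for i
    using H cyc that by (auto simp: finite_simple_graph_def cyclic_edges_def)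
  have inj: "inj_on g (verts H)"
    using g by (simp add: edge_embedding_def)
  have "g ` h i = g ` h j \<longleftrightarrow> h i = h j" if "i < n" "j < n" for i j
    using inj_on_image_eq_iff[OF inj sub sub] that .
  moreover have "disjnt (g ` h i) (g ` h j) \<longleftrightarrow> disjnt (h i) (h j)" if "i < n" "j < n" for i j
    using inj_on_image_Int[OF inj sub[OF that(1)] sub[OF that(2)]]
    by (metis disjnt_def image_is_empty)
  ultimately show ?thesis
    using cyc g by (auto simp: cyclic_edges_def edge_embedding_def inj_on_def image_image)
qed

text \<open>
  The model graphs live on types of pairs and sums; encoding their vertices as numbers gives
  copies on the natural numbers.
\<close>

lemma nat_graph_exists:
  fixes H :: "'b::countable graph"
  assumes H: "finite_simple_graph H" "no_isolated_verts H"
  shows "\<exists>G :: nat graph. finite_simple_graph G \<and> no_isolated_verts G \<and> (\<exists>g. edge_embedding g H G)"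
proof -
  let ?G = "\<lparr>verts = to_nat ` verts H, edges = (`) to_nat ` edges H\<rparr>"
  have "edge_embedding to_nat H ?G"
    by (simp add: edge_embedding_def)
  moreover have "finite_simple_graph ?G" "no_isolated_verts ?G"
    using H by (auto simp: finite_simple_graph_def no_isolated_verts_def card_image inj_image_mem_iff)
  ultimately show ?thesis
    by blast
qed

section \<open>The three graphs\<close>

lemma verts_two_P3:
  "verts (disjoint_copies 2 (path_graph 3)) = {(0,0), (0,1), (0,2), (1,0), (1,1), (1,2)}"
  by (auto simp: disjoint_copies_def path_graph_def)

lemma edges_two_P3:
  "edges (disjoint_copies 2 (path_graph 3)) =
    {{(0,0), (0,1)}, {(0,1), (0,2)}, {(1,0), (1,1)}, {(1,1), (1,2)}}"
proof -
  have "edges (path_graph 3) = {{0, 1}, {1, 2}}"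
    by (auto simp: path_graph_def less_Suc_eq numeral_3_eq_3 numeral_2_eq_2)
  moreover have "edges (disjoint_copies 2 (path_graph 3)) =
      (\<Union>i\<in>{..<2}. (`) (Pair i) ` edges (path_graph 3))"
    by (auto simp: disjoint_copies_def)
  moreover have "{..<2} = {0, 1 :: nat}"
    by auto
  ultimately show ?thesis
    by auto
qed

lemma verts_C5: "verts (cycle_graph 5) = {0, 1, 2, 3, 4}"
  by (auto simp: cycle_graph_def)

lemma edges_C5: "edges (cycle_graph 5) = {{0, 1}, {1, 2}, {2, 3}, {3, 4}, {4, 0}}"
proof -
  have "edges (cycle_graph 5) = (\<lambda>i. {i, Suc i mod 5}) ` {..<5}"
    by (auto simp: cycle_graph_def)
  moreover have "{..<5} = {0, 1, 2, 3, 4 :: nat}"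
    by auto
  ultimately show ?thesis
    by (simp add: numeral_2_eq_2)
qed

lemma verts_K32:
  "verts (complete_bipartite_graph 3 2) = {Inl 0, Inl 1, Inl 2, Inr 0, Inr 1}"
  by (auto simp: complete_bipartite_graph_def)

lemma edges_K32:
  "edges (complete_bipartite_graph 3 2) =
    {{Inl 0, Inr 0}, {Inl 1, Inr 0}, {Inl 2, Inr 0}, {Inl 0, Inr 1}, {Inl 1, Inr 1}, {Inl 2, Inr 1}}"
proof -
  have "edges (complete_bipartite_graph 3 2) =
      (\<Union>i\<in>{..<3}. \<Union>j\<in>{..<2}. {{Inl i, Inr j}})"
    by (auto simp: complete_bipartite_graph_def)
  moreover have "{..<2} = {0, 1 :: nat}" "{..<3} = {0, 1, 2 :: nat}"
    by auto
  ultimately show ?thesis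
    by auto
qed

lemma two_P3_graph:
  "finite_simple_graph (disjoint_copies 2 (path_graph 3))"
  "no_isolated_verts (disjoint_copies 2 (path_graph 3))"
  by (simp_all add: finite_simple_graph_def no_isolated_verts_def verts_two_P3 edges_two_P3)

lemma C5_graph: "finite_simple_graph (cycle_graph 5)" "no_isolated_verts (cycle_graph 5)"
  by (simp_all add: finite_simple_graph_def no_isolated_verts_def verts_C5 edges_C5)

lemma K32_graph:
  "finite_simple_graph (complete_bipartite_graph 3 2)"
  "no_isolated_verts (complete_bipartite_graph 3 2)"
  by (simp_all add: finite_simple_graph_def no_isolated_verts_def verts_K32 edges_K32)

lemma lessThan_numerals:
  "{..<4} = {0, 1, 2, 3 :: nat}" "{..<5} = {0, 1, 2, 3, 4 :: nat}"
  "{..<6} = {0, 1, 2, 3, 4, 5 :: nat}"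
  by auto

text \<open>
  With quantifiers bounded by sets, a numeral bound can be replaced by an enumeration.
\<close>

lemma cyclic_edges_ball:
  "cyclic_edges G n e \<longleftrightarrow> inj_on e {..<n} \<and> edges G = e ` {..<n} \<and>
    (\<forall>i\<in>{..<n}. \<forall>j\<in>{..<n}. i \<noteq> j \<longrightarrow>
      (disjnt (e i) (e j) \<longleftrightarrow> j = Suc i mod n \<or> i = Suc j mod n))"
  by (simp add: cyclic_edges_def Ball_def)

text \<open>
  The cyclic order alternates between the two components.
\<close>

lemma cyclic_edges_two_P3:
  "cyclic_edges (disjoint_copies 2 (path_graph 3)) 4
    ((!) [{(0,0), (0,1)}, {(1,0), (1,1)}, {(0,1), (0,2)}, {(1,1), (1,2)}])"
  unfolding cyclic_edges_ball lessThan_numerals edges_two_P3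
  by (simp add: doubleton_eq_iff insert_commute)

text \<open>
  In \<open>C\<^sub>5\<close> an edge is disjoint from the two edges at distance two from it, so the cyclic order
  of the matching complex is a pentagram.
\<close>

lemma cyclic_edges_C5:
  "cyclic_edges (cycle_graph 5) 5 ((!) [{0, 1}, {3, 4}, {1, 2}, {4, 0}, {2, 3}])"
  unfolding cyclic_edges_ball lessThan_numerals edges_C5
  by (simp add: doubleton_eq_iff insert_commute)

text \<open>
  Consecutive edges alternate between the two vertices of the smaller side and run cyclically
  through the three vertices of the larger side.
\<close>

lemma cyclic_edges_K32:
  "cyclic_edges (complete_bipartite_graph 3 2) 6
    ((!) [{Inl 0, Inr 0}, {Inl 1, Inr 1}, {Inl 2, Inr 0}, {Inl 0, Inr 1}, {Inl 1, Inr 0},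
      {Inl 2, Inr 1}])"
  unfolding cyclic_edges_ball lessThan_numerals edges_K32
  by (simp add: doubleton_eq_iff insert_commute)

lemma other_endpoint:
  assumes "card f = 2" "x \<in> f"
  shows "\<exists>y. y \<noteq> x \<and> f = {x, y}"
proof -
  obtain p q where "f = {p, q}" "p \<noteq> q"
    using assms(1) by (auto simp: card_2_iff)
  then show ?thesis
    using assms(2) by (cases "x = p") (auto simp: insert_commute)
qed

lemma endpoints_of_meeting_edges:
  assumes "card x = 2" "card y = 2" "x \<noteq> y" "\<not> disjnt x y"
  obtains a b c where "distinct [a, b, c]" "x = {a, b}" "y = {b, c}"
proof -
  obtain b where b: "b \<in> x" "b \<in> y"
    using assms(4) by (auto simp: disjnt_def)
  obtain a where a: "a \<noteq> b" "x = {b, a}"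
    using other_endpoint[OF assms(1) b(1)] by blast
  obtain c where c: "c \<noteq> b" "y = {b, c}"
    using other_endpoint[OF assms(2) b(2)] by blast
  show ?thesis
    using that[of a b c] a c assms(3) by (auto simp: insert_commute)
qed

text \<open>
  \<open>e 0\<close> and \<open>e 2\<close> meet, as do \<open>e 1\<close> and \<open>e 3\<close>, and every edge of the first pair is disjoint
  from every edge of the second.
\<close>

lemma embedding_two_P3:
  assumes G: "finite_simple_graph G" and cyc: "cyclic_edges G 4 e"
  shows "\<exists>g. edge_embedding g (disjoint_copies 2 (path_graph 3)) G"
proof -
  note card = card_edge[OF G cyc]
  have adj: "disjnt (e i) (e j) \<longleftrightarrow> j = Suc i mod 4 \<or> i = Suc j mod 4"
    and neq: "e i \<noteq> e j" if "i < 4" "j < 4" "i \<noteq> j" for i j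
    using cyc that by (simp_all add: cyclic_edges_def inj_on_eq_iff[of e "{..<4}"])
  obtain a b c where abc: "distinct [a, b, c]" "e 0 = {a, b}" "e 2 = {b, c}"
    by (rule endpoints_of_meeting_edges[of "e 0" "e 2"]) (simp_all add: card adj neq)
  obtain p q r where pqr: "distinct [p, q, r]" "e 1 = {p, q}" "e 3 = {q, r}"
    by (rule endpoints_of_meeting_edges[of "e 1" "e 3"]) (simp_all add: card adj neq)
  have "disjnt (e 0) (e 1)" "disjnt (e 0) (e 3)" "disjnt (e 2) (e 1)" "disjnt (e 2) (e 3)"
    by (simp_all add: adj)
  then have dist: "distinct [a, b, c, p, q, r]"
    using abc pqr by auto
  have E: "edges G = {{a, b}, {p, q}, {b, c}, {q, r}}"
    using cyc abc pqr by (simp add: cyclic_edges_def lessThan_numerals del: One_nat_def)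
  let ?g = "\<lambda>(i, j). ([[a, b, c], [p, q, r]] ! i) ! j"
  have "edge_embedding ?g (disjoint_copies 2 (path_graph 3)) G"
    unfolding edge_embedding_def verts_two_P3 edges_two_P3 E
    using dist by (auto simp: insert_commute)
  then show ?thesis
    by blast
qed

text \<open>
  In the order \<open>e 0, e 2, e 4, e 1, e 3\<close> consecutive edges meet and all other pairs are disjoint,
  so the edges follow each other around a pentagon.
\<close>

lemma embedding_C5:
  assumes G: "finite_simple_graph G" and cyc: "cyclic_edges G 5 e"
  shows "\<exists>g. edge_embedding g (cycle_graph 5) G"
proof -
  note card = card_edge[OF G cyc]
  have adj: "disjnt (e i) (e j) \<longleftrightarrow> j = Suc i mod 5 \<or> i = Suc j mod 5"
    and neq: "e i \<noteq> e j" if "i < 5" "j < 5" "i \<noteq> j" for i j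
    using cyc that by (simp_all add: cyclic_edges_def inj_on_eq_iff[of e "{..<5}"])
  obtain a b c where abc: "distinct [a, b, c]" "e 0 = {a, b}" "e 2 = {b, c}"
    by (rule endpoints_of_meeting_edges[of "e 0" "e 2"]) (simp_all add: card adj neq)
  have "disjnt (e 4) (e 0)" "\<not> disjnt (e 4) (e 2)"
    by (simp_all add: adj)
  then have "a \<notin> e 4" "b \<notin> e 4" "c \<in> e 4"
    by (auto simp: abc disjnt_def simp del: One_nat_def)
  then obtain d where d: "e 4 = {c, d}" "d \<noteq> a" "d \<noteq> b" "d \<noteq> c"
    using other_endpoint[OF card[of 4], of c] by auto
  have "disjnt (e 1) (e 0)" "disjnt (e 1) (e 2)" "\<not> disjnt (e 1) (e 4)"
    by (simp_all add: adj)
  then have "a \<notin> e 1" "b \<notin> e 1" "c \<notin> e 1" "d \<in> e 1"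
    by (auto simp: abc d disjnt_def simp del: One_nat_def)
  then obtain x where x: "e 1 = {d, x}" "x \<noteq> a" "x \<noteq> b" "x \<noteq> c" "x \<noteq> d"
    using other_endpoint[OF card[of 1], of d] by auto
  have "disjnt (e 3) (e 2)" "disjnt (e 3) (e 4)" "\<not> disjnt (e 3) (e 0)" "\<not> disjnt (e 3) (e 1)"
    by (simp_all add: adj)
  then have "x \<in> e 3" "a \<in> e 3"
    by (auto simp: abc d x disjnt_def simp del: One_nat_def)
  then have e3: "e 3 = {x, a}"
    using other_endpoint[OF card[of 3], of x] x by auto
  have E: "edges G = {{a, b}, {d, x}, {b, c}, {x, a}, {c, d}}"
    using cyc by (simp add: cyclic_edges_def lessThan_numerals abc d(1) x(1) e3 del: One_nat_def)
  have "edge_embedding ((!) [a, b, c, d, x]) (cycle_graph 5) G"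
    unfolding edge_embedding_def verts_C5 edges_C5 E
    using abc(1) d x by (auto simp: insert_commute)
  then show ?thesis
    by blast
qed

text \<open>
  \<open>e 0\<close> and \<open>e 1\<close> are disjoint and \<open>e 3\<close> and \<open>e 4\<close> are the disjoint edges joining them, which
  gives a quadrilateral on \<open>a, b, c, d\<close>.  The edge \<open>e 2\<close> leaves it at \<open>b\<close>, the edge \<open>e 5\<close> leaves it
  at the opposite vertex \<open>c\<close>, and they meet, hence at a new vertex \<open>x\<close>.  The sides of the bipartition
  are \<open>{a, d, x}\<close> and \<open>{b, c}\<close>.
\<close>

lemma embedding_K32:
  assumes G: "finite_simple_graph G" and cyc: "cyclic_edges G 6 e"
  shows "\<exists>g. edge_embedding g (complete_bipartite_graph 3 2) G"
proof -
  note card = card_edge[OF G cyc]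
  have adj: "disjnt (e i) (e j) \<longleftrightarrow> j = Suc i mod 6 \<or> i = Suc j mod 6"
    and neq: "e i \<noteq> e j" if "i < 6" "j < 6" "i \<noteq> j" for i j
    using cyc that by (simp_all add: cyclic_edges_def inj_on_eq_iff[of e "{..<6}"])
  obtain b a c where abc: "distinct [b, a, c]" "e 0 = {b, a}" "e 3 = {a, c}"
    by (rule endpoints_of_meeting_edges[of "e 0" "e 3"]) (simp_all add: card adj neq)
  have "disjnt (e 1) (e 0)" "\<not> disjnt (e 1) (e 3)"
    by (simp_all add: adj)
  then have "a \<notin> e 1" "b \<notin> e 1" "c \<in> e 1"
    by (auto simp: abc disjnt_def simp del: One_nat_def)
  then obtain d where d: "e 1 = {c, d}" "d \<noteq> a" "d \<noteq> b" "d \<noteq> c"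
    using other_endpoint[OF card[of 1], of c] by auto
  have "disjnt (e 4) (e 3)" "\<not> disjnt (e 4) (e 0)" "\<not> disjnt (e 4) (e 1)"
    by (simp_all add: adj)
  then have "b \<in> e 4" "d \<in> e 4"
    by (auto simp: abc d disjnt_def simp del: One_nat_def)
  then have e4: "e 4 = {b, d}"
    using other_endpoint[OF card[of 4], of b] d by auto
  have "disjnt (e 2) (e 3)" "disjnt (e 2) (e 1)" "\<not> disjnt (e 2) (e 0)"
    by (simp_all add: adj)
  then have "a \<notin> e 2" "c \<notin> e 2" "d \<notin> e 2" "b \<in> e 2"
    by (auto simp: abc d disjnt_def simp del: One_nat_def)
  then obtain x where x: "e 2 = {b, x}" "x \<noteq> a" "x \<noteq> b" "x \<noteq> c" "x \<noteq> d"
    using other_endpoint[OF card[of 2], of b] by auto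
  have "disjnt (e 5) (e 0)" "disjnt (e 5) (e 4)" "\<not> disjnt (e 5) (e 1)" "\<not> disjnt (e 5) (e 2)"
    by (simp_all add: adj)
  then have "c \<in> e 5" "x \<in> e 5"
    by (auto simp: abc d x e4 disjnt_def simp del: One_nat_def)
  then have e5: "e 5 = {c, x}"
    using other_endpoint[OF card[of 5], of c] x by auto
  have E: "edges G = {{b, a}, {c, d}, {b, x}, {a, c}, {b, d}, {c, x}}"
    using cyc by (simp add: cyclic_edges_def lessThan_numerals abc d(1) x(1) e4 e5 del: One_nat_def)
  let ?g = "case_sum ((!) [a, d, x]) ((!) [b, c])"
  have "edge_embedding ?g (complete_bipartite_graph 3 2) G"
    unfolding edge_embedding_def verts_K32 edges_K32 E
    using abc(1) d x by (auto simp: insert_commute)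
  then show ?thesis
    by blast
qed

lemma matching_complex_cycle_iff_graph_iso:
  assumes G: "finite_simple_graph G" "no_isolated_verts G"
    and H: "finite_simple_graph H" "no_isolated_verts H"
    and n: "n \<ge> 4" and cyc: "cyclic_edges H n h"
    and emb: "\<And>e. cyclic_edges G n e \<Longrightarrow> \<exists>g. edge_embedding g H G"
  shows "complex_iso (matching_complex G) (graph_complex (cycle_graph n)) \<longleftrightarrow> graph_iso G H"
  unfolding complex_iso_matching_complex_iff[OF n] graph_iso_iff_edge_embedding[OF G H]
  using emb cyclic_edges_transfer[OF H(1) cyc] by blast

lemma homology_sphere_matching_complex_iff:
  assumes G: "finite_simple_graph G"
  shows "homology_sphere TYPE('k::field) 1 (matching_complex G) \<longleftrightarrow>
    (\<exists>n\<in>{4, 5, 6}. complex_iso (matching_complex G) (graph_complex (cycle_graph n)))"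
proof
  assume "homology_sphere TYPE('k) 1 (matching_complex G)"
  then obtain n e where e: "n \<ge> 3" "inj_on e {..<n}" "matching_complex G = cycle_complex n e"
    by (auto simp: homology_sphere_1_iff)
  have "n \<noteq> 3"
    using e matching_complex_not_triangle by blast
  moreover have "n \<le> 6"
    using cyclic_edges_le_6[OF G cyclic_edges_if_matching_complex[OF e(2,3)]] .
  ultimately have "n \<in> {4, 5, 6}"
    using e(1) by auto
  then show "\<exists>n\<in>{4, 5, 6}. complex_iso (matching_complex G) (graph_complex (cycle_graph n))"
    using e unfolding complex_iso_cycle_graph_iff by blast
next
  assume "\<exists>n\<in>{4, 5, 6}. complex_iso (matching_complex G) (graph_complex (cycle_graph n))"
  then obtain n e where "n \<in> {4, 5, 6}" "inj_on e {..<n}" "matching_complex G = cycle_complex n e"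
    unfolding complex_iso_cycle_graph_iff by blast
  moreover from this(1) have "n \<ge> 3"
    by auto
  ultimately show "homology_sphere TYPE('k) 1 (matching_complex G)"
    unfolding homology_sphere_1_iff by blast
qed

lemma matching_complex_realizes_cycle:
  fixes H :: "'b::countable graph"
  assumes H: "finite_simple_graph H" "no_isolated_verts H"
    and n: "n \<ge> 4" and cyc: "cyclic_edges H n h"
  shows "\<exists>G :: nat graph. finite_simple_graph G \<and> no_isolated_verts G \<and>
    complex_iso (matching_complex G) (graph_complex (cycle_graph n))"
  unfolding complex_iso_matching_complex_iff[OF n]
  using nat_graph_exists[OF H] cyclic_edges_transfer[OF H(1) cyc] by blast

theorem theorem3p1:
  "(\<forall>G :: 'a graph. finite_simple_graph G \<and> no_isolated_verts G \<longrightarrow>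
      (homology_sphere TYPE('k::field) 1 (matching_complex G) \<longleftrightarrow>
        (\<exists>n\<in>{4, 5, 6}. complex_iso (matching_complex G) (graph_complex (cycle_graph n)))))
   \<and> (\<forall>n\<in>{4, 5, 6}.
        homology_sphere TYPE('k) 1 (graph_complex (cycle_graph n)) \<and>
        (\<exists>G :: nat graph. finite_simple_graph G \<and> no_isolated_verts G \<and>
           complex_iso (matching_complex G) (graph_complex (cycle_graph n))))
   \<and> (\<forall>G :: 'a graph. finite_simple_graph G \<and> no_isolated_verts G \<longrightarrow>
        (complex_iso (matching_complex G) (graph_complex (cycle_graph 4)) \<longleftrightarrow>
          graph_iso G (disjoint_copies 2 (path_graph 3))) \<and>
        (complex_iso (matching_complex G) (graph_complex (cycle_graph 5)) \<longleftrightarrow>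
          graph_iso G (cycle_graph 5)) \<and>
        (complex_iso (matching_complex G) (graph_complex (cycle_graph 6)) \<longleftrightarrow>
          graph_iso G (complete_bipartite_graph 3 2)))"
proof (intro conjI allI impI ballI)
  fix G :: "'a graph"
  assume "finite_simple_graph G \<and> no_isolated_verts G"
  then have G: "finite_simple_graph G" "no_isolated_verts G"
    by simp_all
  show "homology_sphere TYPE('k) 1 (matching_complex G) \<longleftrightarrow>
      (\<exists>n\<in>{4, 5, 6}. complex_iso (matching_complex G) (graph_complex (cycle_graph n)))"
    by (rule homology_sphere_matching_complex_iff[OF G(1)])
  show "complex_iso (matching_complex G) (graph_complex (cycle_graph 4)) \<longleftrightarrow>
      graph_iso G (disjoint_copies 2 (path_graph 3))"
    by (rule matching_complex_cycle_iff_graph_iso[OF G two_P3_graph _ cyclic_edges_two_P3])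
      (simp_all add: embedding_two_P3[OF G(1)])
  show "complex_iso (matching_complex G) (graph_complex (cycle_graph 5)) \<longleftrightarrow>
      graph_iso G (cycle_graph 5)"
    by (rule matching_complex_cycle_iff_graph_iso[OF G C5_graph _ cyclic_edges_C5])
      (simp_all add: embedding_C5[OF G(1)])
  show "complex_iso (matching_complex G) (graph_complex (cycle_graph 6)) \<longleftrightarrow>
      graph_iso G (complete_bipartite_graph 3 2)"
    by (rule matching_complex_cycle_iff_graph_iso[OF G K32_graph _ cyclic_edges_K32])
      (simp_all add: embedding_K32[OF G(1)])
next
  fix n :: nat
  assume n: "n \<in> {4, 5, 6}"
  then have "n \<ge> 3"
    by auto
  then show "homology_sphere TYPE('k) 1 (graph_complex (cycle_graph n))"
    unfolding homology_sphere_1_iff graph_complex_cycle_graph by (metis inj_on_id)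
  show "\<exists>G :: nat graph. finite_simple_graph G \<and> no_isolated_verts G \<and>
      complex_iso (matching_complex G) (graph_complex (cycle_graph n))"
    using n matching_complex_realizes_cycle[OF two_P3_graph _ cyclic_edges_two_P3]
      matching_complex_realizes_cycle[OF C5_graph _ cyclic_edges_C5]
      matching_complex_realizes_cycle[OF K32_graph _ cyclic_edges_K32]
    by auto
qed

end
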